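(* The B-Z constant for the family of $3\times n$ torus graphs ($n\ge 3$) exists and equals $\frac{24\sqrt{21}-104}{21}$; that is, $$\lim_{n\to\infty}\frac{\sum_{T\in\mathcal{T}(C_3\times C_n)}|\mathcal{L}(T)|}{3n\cdot\tau(C_3\times C_n)}=\frac{24\sqrt{21}-104}{21}.$$
   Context: All graphs are finite and simple. For $a,b\ge 3$, the $a\times b$ torus graph $C_a\times C_b$ has vertex set $\{(i,j): 1\le i\le a,\ 1\le j\le b\}$, and $(u_1,u_2)$ and $(v_1,v_2)$ are adjacent iff either $|u_1-v_1|\in\{1,a-1\}$ and $u_2=v_2$, or $u_1=v_1$ and $|u_2-v_2|\in\{1,b-1\}$. $\mathcal{T}(G)$ is the set of labeled spanning trees of $G$, $\tau(G)=|\mathcal{T}(G)|$, and $\mathcal{L}(T)$ is the set of leaves (vertices of degree exactly $1$ in $T$) of a tree $T$. The B-Z constant of a graph family (with members indexed by number of vertices) is the limit of $\frac{\sum_{T\in\mathcal{T}(G)}|\mathcal{L}(T)|}{|V(G)|\,\tau(G)}$ as $|V(G)|\to\infty$ along members $G$ of the family, whenever the limit exists. *)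

theory Defs
  imports Complex_Main
begin

text \<open>Graphs are pairs of a vertex set and a set of edges, an edge being a two-element set of
  vertices.\<close>

type_synonym 'a ugraph = "'a set \<times> 'a set set"

abbreviation uverts :: "'a ugraph \<Rightarrow> 'a set" where
  "uverts G \<equiv> fst G"

abbreviation uedges :: "'a ugraph \<Rightarrow> 'a set set" where
  "uedges G \<equiv> snd G"

definition finite_simple_ugraph :: "'a ugraph \<Rightarrow> bool" where
  "finite_simple_ugraph G \<longleftrightarrow>
     finite (uverts G) \<and> (\<forall>e\<in>uedges G. e \<subseteq> uverts G \<and> card e = 2)"

definition ugraph_adjacent :: "'a ugraph \<Rightarrow> 'a rel" where
  "ugraph_adjacent G = {(u, v). {u, v} \<in> uedges G}"

definition ugraph_connected :: "'a ugraph \<Rightarrow> bool" where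
  "ugraph_connected G \<longleftrightarrow>
     uverts G \<noteq> {} \<and> (\<forall>u\<in>uverts G. \<forall>v\<in>uverts G. (u, v) \<in> (ugraph_adjacent G)\<^sup>*)"

text \<open>A cycle is listed without repeating its first vertex at the end; the index modulo the length
  supplies the closing edge.\<close>

definition ugraph_cycle :: "'a ugraph \<Rightarrow> 'a list \<Rightarrow> bool" where
  "ugraph_cycle G c \<longleftrightarrow>
     length c \<ge> 3 \<and> distinct c \<and>
     (\<forall>i<length c. {c ! i, c ! (Suc i mod length c)} \<in> uedges G)"

definition ugraph_tree :: "'a ugraph \<Rightarrow> bool" where
  "ugraph_tree T \<longleftrightarrow>
     finite_simple_ugraph T \<and> ugraph_connected T \<and> (\<nexists>c. ugraph_cycle T c)"

definition ugraph_spanning_trees :: "'a ugraph \<Rightarrow> 'a ugraph set" where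
  "ugraph_spanning_trees G =
     {T. ugraph_tree T \<and> uverts T = uverts G \<and> uedges T \<subseteq> uedges G}"

definition ugraph_tau :: "'a ugraph \<Rightarrow> nat" where
  "ugraph_tau G = card (ugraph_spanning_trees G)"

definition ugraph_degree :: "'a ugraph \<Rightarrow> 'a \<Rightarrow> nat" where
  "ugraph_degree G v = card {e \<in> uedges G. v \<in> e}"

definition ugraph_leaves :: "'a ugraph \<Rightarrow> 'a set" where
  "ugraph_leaves T = {v \<in> uverts T. ugraph_degree T v = 1}"

definition BZ_ratio :: "'a ugraph \<Rightarrow> real" where
  "BZ_ratio G =
     real (\<Sum>T\<in>ugraph_spanning_trees G. card (ugraph_leaves T)) /
     (real (card (uverts G)) * real (ugraph_tau G))"

text \<open>The filter describes \<open>|V(G)| \<rightarrow> \<infinity>\<close> along the members of the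
  family \<open>\<F>\<close>.\<close>

definition members_at_top :: "'a ugraph set \<Rightarrow> 'a ugraph filter" where
  "members_at_top \<F> = inf (principal \<F>) (filtercomap (\<lambda>G. card (uverts G)) at_top)"

text \<open>The first conjunct says that \<open>\<F>\<close> has members of arbitrarily large order; without it every
  number would be a limit.\<close>

definition has_BZ_constant :: "'a ugraph set \<Rightarrow> real \<Rightarrow> bool" where
  "has_BZ_constant \<F> c \<longleftrightarrow>
     members_at_top \<F> \<noteq> bot \<and> (BZ_ratio \<longlongrightarrow> c) (members_at_top \<F>)"

text \<open>The differences are taken in \<open>int\<close>, as subtraction on \<open>nat\<close> truncates.\<close>

definition torus_adjacent :: "nat \<Rightarrow> nat \<Rightarrow> nat \<times> nat \<Rightarrow> nat \<times> nat \<Rightarrow> bool" where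
  "torus_adjacent a b u v \<longleftrightarrow>
     (\<bar>int (fst u) - int (fst v)\<bar> \<in> {1, int a - 1} \<and> snd u = snd v) \<or>
     (fst u = fst v \<and> \<bar>int (snd u) - int (snd v)\<bar> \<in> {1, int b - 1})"

definition torus_ugraph :: "nat \<Rightarrow> nat \<Rightarrow> (nat \<times> nat) ugraph" where
  "torus_ugraph a b =
     ({1..a} \<times> {1..b},
      {{u, v} |u v. u \<in> {1..a} \<times> {1..b} \<and> v \<in> {1..a} \<times> {1..b} \<and> torus_adjacent a b u v})"

lemma finite_simple_torus_ugraph:
  assumes "a \<ge> 3" "b \<ge> 3"
  shows "finite_simple_ugraph (torus_ugraph a b)"
proof -
  have neq: "u \<noteq> v" if "torus_adjacent a b u v" for u v
    using that assms by (auto simp: torus_adjacent_def)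
  have "e \<subseteq> uverts (torus_ugraph a b) \<and> card e = 2" if e: "e \<in> uedges (torus_ugraph a b)" for e
  proof -
    obtain u v where uv: "e = {u, v}" "u \<in> {1..a} \<times> {1..b}" "v \<in> {1..a} \<times> {1..b}"
        "torus_adjacent a b u v"
      using e unfolding torus_ugraph_def snd_conv by blast
    have "card e = 2"
      using neq[OF uv(4)] uv(1) by simp
    moreover have "e \<subseteq> uverts (torus_ugraph a b)"
      unfolding uv(1) torus_ugraph_def fst_conv using uv(2,3) by blast
    ultimately show ?thesis by blast
  qed
  then show ?thesis
    unfolding finite_simple_ugraph_def by (simp add: torus_ugraph_def)
qed

end

theory Submission
  imports Defs "HOL-Library.Transitive_Closure_Table"
begin

text \<open>
Why the limit is \<open>(24 \<surd>21 - 104) / 21\<close>.  Fix a vertex \<open>v\<close> of \<open>G = C\<^sub>3 \<times> C\<^sub>n\<close>.  The spanning trees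
of \<open>G\<close> that have \<open>v\<close> as a leaf split into four classes, one for each edge at \<open>v\<close>, and moving the
pendant edge to another neighbour is a bijection between the classes.  So their number is four
times the number of spanning trees that avoid three chosen edges at \<open>v\<close>
(\<open>card_leaf_trees\<close>, \<open>pendant_trees_eq_trees\<close>).  The proportion of spanning trees avoiding three
edges does not depend on \<open>v\<close>, so four times it is the ratio in question.

That proportion comes from electrical networks.  Kirchhoff's theorem
(\<open>card_trees_containing_edge\<close>) says that the proportion of spanning trees containing an edge \<open>ab\<close>
is the voltage between \<open>a\<close> and \<open>b\<close> when a unit current flows from \<open>a\<close> to \<open>b\<close>.  The proof here is
bijective: for a vertex \<open>w\<close>, let \<open>F w\<close> count the trees \<open>T\<close> containing \<open>ab\<close> for which \<open>w\<close> is on the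
side of \<open>a\<close> in \<open>T - ab\<close>.  Replacing \<open>ab\<close> by an edge \<open>wx\<close> that joins the two sides turns
\<open>F w - F x\<close> into the number of trees whose path from \<open>a\<close> to \<open>b\<close> runs through \<open>w\<close> and then \<open>x\<close>,
minus the number of those in which it runs through \<open>x\<close> and then \<open>w\<close>.  A path leaves every inner
vertex as often as it enters it, so \<open>F\<close> obeys the Kirchhoff laws up to the factor \<open>\<tau>(G)\<close>.

Deleting an edge changes the voltages by a rank-one update (\<open>potential_delete_edge\<close>).  Three
deletions in a row therefore multiply the number of spanning trees by the determinant of
\<open>I - K\<close>, where \<open>K\<close> is the \<open>3 \<times> 3\<close> matrix of voltages across the deleted edges
(\<open>card_trees_delete_three_edges\<close>).

On \<open>C\<^sub>3 \<times> C\<^sub>n\<close> the voltages are explicit.  The Laplacian of the triangle has the eigenvalues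
\<open>0, 3, 3\<close>, so a Green function splits into a Green function of the cycle, which is quadratic, and
a solution of \<open>5 h(k) - h(k + 1) - h(k - 1) = \<delta>(k)\<close> on the cycle, built from powers of the
root \<open>q = (5 - \<surd>21) / 2\<close> of \<open>q\<^sup>2 = 5 q - 1\<close>.  As \<open>n\<close> tends to infinity the entries of \<open>K\<close> converge
to elements of the field generated by \<open>\<surd>21\<close>, and the determinant tends to \<open>(6 \<surd>21 - 26) / 21\<close>.
\<close>

section \<open>Spanning trees as edge sets\<close>

definition reach :: "'a set set \<Rightarrow> 'a rel" where
  "reach F = {(u, v). {u, v} \<in> F}\<^sup>*"

text \<open>A spanning tree is encoded as a connected edge set in which every edge is a bridge.  Unlike the
absence of cycles, this form passes through edge exchanges by pure reachability arguments, without
any manipulation of paths.\<close>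

definition edge_tree :: "'a set \<Rightarrow> 'a set set \<Rightarrow> bool" where
  "edge_tree V F \<longleftrightarrow> (\<forall>u\<in>V. \<forall>v\<in>V. (u, v) \<in> reach F) \<and>
     (\<forall>u v. {u, v} \<in> F \<longrightarrow> (u, v) \<notin> reach (F - {{u, v}}))"

definition trees :: "'a set \<Rightarrow> 'a set set \<Rightarrow> 'a set set set" where
  "trees V E = {F. F \<subseteq> E \<and> edge_tree V F}"

lemma reach_refl [simp]: "(u, u) \<in> reach F"
  by (simp add: reach_def)

lemma reach_edge: "{u, v} \<in> F \<Longrightarrow> (u, v) \<in> reach F"
  unfolding reach_def by (rule r_into_rtrancl) simp

lemma reach_sym: "(u, v) \<in> reach F \<Longrightarrow> (v, u) \<in> reach F"
  unfolding reach_def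
  by (rule symD[OF sym_rtrancl]) (auto simp: sym_def insert_commute)

lemma reach_trans: "(u, v) \<in> reach F \<Longrightarrow> (v, w) \<in> reach F \<Longrightarrow> (u, w) \<in> reach F"
  unfolding reach_def by (rule rtrancl_trans)

lemma reach_mono: "F \<subseteq> F' \<Longrightarrow> (u, v) \<in> reach F \<Longrightarrow> (u, v) \<in> reach F'"
  unfolding reach_def by (rule rtrancl_mono[THEN subsetD]) auto

lemma reach_insertE:
  assumes "(x, y) \<in> reach (insert {a, b} F)"
  obtains "(x, y) \<in> reach F"
  | "(x, a) \<in> reach F" "(b, y) \<in> reach F"
  | "(x, b) \<in> reach F" "(a, y) \<in> reach F"
proof -
  have "(x, y) \<in> reach F \<or> (x, a) \<in> reach F \<and> (b, y) \<in> reach F \<or>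
      (x, b) \<in> reach F \<and> (a, y) \<in> reach F"
    using assms unfolding reach_def[of "insert _ _"]
  proof (induction rule: rtrancl_induct)
    case (step y z)
    then consider "{y, z} \<in> F" | "y = a" "z = b" | "y = b" "z = a"
      by (auto simp: doubleton_eq_iff)
    then show ?case
      using step.IH by cases (auto dest: reach_edge intro: reach_trans)
  qed simp
  then show thesis using that by blast
qed

lemma reach_invariant:
  assumes "(x, y) \<in> reach F" "P x" "\<And>u v. {u, v} \<in> F \<Longrightarrow> P u \<Longrightarrow> P v"
  shows "P y"
  using assms(1) unfolding reach_def
  by (induction rule: rtrancl_induct) (use assms(2,3) in auto)

text \<open>An edge that is not a bridge closes up with a simple path joining its ends outside it, which is a
cycle; conversely, the rest of a cycle reconnects the ends of its closing edge.\<close>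

lemma bridges_iff_no_cycle:
  assumes "\<forall>e\<in>F. card e = 2"
  shows "(\<forall>u v. {u, v} \<in> F \<longrightarrow> (u, v) \<notin> reach (F - {{u, v}})) \<longleftrightarrow>
    (\<nexists>c. ugraph_cycle (V, F) c)"
proof (intro iffI notI allI impI; (elim exE)?)
  fix c
  assume bridges: "\<forall>u v. {u, v} \<in> F \<longrightarrow> (u, v) \<notin> reach (F - {{u, v}})"
    and "ugraph_cycle (V, F) c"
  then have len: "length c \<ge> 3" and dist: "distinct c"
    and edges: "\<And>i. i < length c \<Longrightarrow> {c ! i, c ! (Suc i mod length c)} \<in> F"
    by (auto simp: ugraph_cycle_def)
  define m where "m = length c - 1"
  have m: "m < length c" "Suc m = length c" "m \<ge> 2"
    using len by (auto simp: m_def)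
  define e where "e = {c ! m, c ! 0}"
  have "(c ! 0, c ! i) \<in> reach (F - {e})" if "i \<le> m" for i
    using that
  proof (induction i)
    case (Suc i)
    have "c \<noteq> []" using len by auto
    then have "{c ! i, c ! Suc i} \<noteq> e"
      using Suc.prems m nth_eq_iff_index_eq[OF dist, of i 0] nth_eq_iff_index_eq[OF dist, of i m]
        nth_eq_iff_index_eq[OF dist, of "Suc i" m]
      by (auto simp: e_def doubleton_eq_iff)
    moreover have "{c ! i, c ! Suc i} \<in> F"
      using edges[of i] Suc.prems m by simp
    ultimately have "(c ! i, c ! Suc i) \<in> reach (F - {e})"
      by (intro reach_edge) simp
    with Suc show ?case by (auto intro: reach_trans)
  qed simp
  then have "(c ! m, c ! 0) \<in> reach (F - {{c ! m, c ! 0}})"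
    unfolding e_def by (auto intro: reach_sym)
  moreover have "{c ! m, c ! 0} \<in> F"
    using edges[of m] m by simp
  ultimately show False using bridges by blast
next
  fix u v
  assume acyclic: "\<nexists>c. ugraph_cycle (V, F) c" and uv: "{u, v} \<in> F"
    and "(u, v) \<in> reach (F - {{u, v}})"
  define R where "R = (\<lambda>x y. {x, y} \<in> F - {{u, v}})"
  have "R\<^sup>*\<^sup>* u v"
    using \<open>(u, v) \<in> reach _\<close> unfolding reach_def R_def by (simp add: rtranclp_rtrancl_eq)
  then obtain ys where "rtrancl_path R u ys v"
    unfolding rtranclp_eq_rtrancl_path by blast
  then obtain xs where path: "rtrancl_path R u xs v" and dist: "distinct (u # xs)"
    by (rule rtrancl_path_distinct)
  have "u \<noteq> v" using assms uv by force
  then have "xs \<noteq> []"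
    using path by (auto elim: rtrancl_path.cases)
  then have last: "last xs = v"
    using path by (auto dest: rtrancl_path_last)
  have step: "R ((u # xs) ! i) (xs ! i)" if "i < length xs" for i
    using rtrancl_path_nth[OF path that] .
  \<comment> \<open>The path avoids the edge \<open>uv\<close>, so it has at least three vertices.\<close>
  have "length xs \<noteq> 1"
  proof
    assume "length xs = 1"
    then have "xs = [v]" using last by (cases xs) auto
    then show False using step[of 0] by (simp add: R_def)
  qed
  then have "length (u # xs) \<ge> 3" using \<open>xs \<noteq> []\<close> by (cases xs; cases "tl xs") auto
  moreover have "{(u # xs) ! i, (u # xs) ! (Suc i mod length (u # xs))} \<in> F"
    if "i < length (u # xs)" for i
  proof (cases "i = length xs")
    case True
    then have "(u # xs) ! i = v"
      using last \<open>xs \<noteq> []\<close> by (simp add: last_conv_nth)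
    then show ?thesis using True uv by (simp add: insert_commute)
  next
    case False
    then have "i < length xs" using that by simp
    then show ?thesis using step[of i] by (simp add: R_def)
  qed
  ultimately have "ugraph_cycle (V, F) (u # xs)"
    using dist unfolding ugraph_cycle_def by simp
  with acyclic show False by blast
qed

lemma spanning_trees_eq_trees:
  assumes "finite_simple_ugraph (V, E)" "V \<noteq> {}"
  shows "ugraph_spanning_trees (V, E) = Pair V ` trees V E"
proof -
  have *: "ugraph_tree (V, F) \<longleftrightarrow> edge_tree V F" if "F \<subseteq> E" for F
  proof -
    have "finite_simple_ugraph (V, F)" "\<forall>e\<in>F. card e = 2"
      using assms that by (auto simp: finite_simple_ugraph_def)
    then show ?thesis
      using assms bridges_iff_no_cycle[of F V] unfolding ugraph_tree_def edge_tree_def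
      by (simp add: ugraph_connected_def ugraph_adjacent_def reach_def)
  qed
  show ?thesis
  proof (intro set_eqI)
    fix T :: "'a ugraph"
    obtain W F where T: "T = (W, F)" by (cases T)
    show "T \<in> ugraph_spanning_trees (V, E) \<longleftrightarrow> T \<in> Pair V ` trees V E"
      unfolding T ugraph_spanning_trees_def trees_def using * by auto
  qed
qed

lemma edge_tree_bridge:
  "edge_tree V T \<Longrightarrow> {a, b} \<in> T \<Longrightarrow> (a, b) \<notin> reach (T - {{a, b}})"
  by (simp add: edge_tree_def)

text \<open>The path of the tree from \<open>a\<close> to \<open>y\<close> either avoids the edge \<open>ab\<close> or starts with it; that \<open>ab\<close> is a
bridge excludes that \<open>y\<close> can be reached from both ends.\<close>

lemma edge_tree_sides:
  assumes "edge_tree V T" "{a, b} \<in> T" "a \<in> V" "y \<in> V"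
  shows "(b, y) \<in> reach (T - {{a, b}}) \<longleftrightarrow> (a, y) \<notin> reach (T - {{a, b}})"
proof -
  have "(a, y) \<in> reach T" using assms by (auto simp: edge_tree_def)
  then have "(a, y) \<in> reach (insert {a, b} (T - {{a, b}}))"
    using assms by (simp add: insert_absorb)
  then have "(a, y) \<in> reach (T - {{a, b}}) \<or> (b, y) \<in> reach (T - {{a, b}})"
    by (rule reach_insertE) auto
  moreover have "(a, b) \<notin> reach (T - {{a, b}})"
    using assms by (intro edge_tree_bridge)
  ultimately show ?thesis by (meson reach_sym reach_trans)
qed

text \<open>The exchange property of spanning trees.  It holds because the old edge and the new one join the
same two components of \<open>T - ab\<close>.\<close>

lemma edge_tree_exchange:
  assumes T: "edge_tree V T" "{a, b} \<in> T" and "a \<in> V"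
    and aw: "(a, w) \<in> reach (T - {{a, b}})" and bx: "(b, x) \<in> reach (T - {{a, b}})"
  shows "edge_tree V (insert {w, x} (T - {{a, b}}))" and "{w, x} \<notin> T - {{a, b}}"
proof -
  define F where "F = T - {{a, b}}"
  have nab: "(a, b) \<notin> reach F"
    using edge_tree_bridge[OF T] by (simp add: F_def)
  have aw: "(a, w) \<in> reach F" and bx: "(b, x) \<in> reach F"
    using aw bx by (auto simp: F_def)
  have nwx: "(w, x) \<notin> reach F"
    using nab aw bx by (meson reach_sym reach_trans)
  then have "{w, x} \<notin> F" by (auto dest: reach_edge)
  then show "{w, x} \<notin> T - {{a, b}}" by (simp add: F_def)
  let ?T' = "insert {w, x} F"
  have up: "(p, q) \<in> reach ?T'" if "(p, q) \<in> reach F" for p q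
    using reach_mono[OF _ that] by blast
  have "(w, x) \<in> reach ?T'" by (intro reach_edge) simp
  then have ab': "(a, b) \<in> reach ?T'"
    using up[OF aw] up[OF bx] by (meson reach_sym reach_trans)
  have conn: "(a, y) \<in> reach ?T'" if "y \<in> V" for y
    using edge_tree_sides[OF T \<open>a \<in> V\<close> that] up ab'
    unfolding F_def[symmetric] by (meson reach_trans)
  have bridge: "(p, q) \<notin> reach (?T' - {{p, q}})" if pq: "{p, q} \<in> ?T'" for p q
  proof
    assume reach: "(p, q) \<in> reach (?T' - {{p, q}})"
    show False
    proof (cases "{p, q} = {w, x}")
      case True
      then have "?T' - {{p, q}} = F" using \<open>{w, x} \<notin> F\<close> by auto
      then have "(p, q) \<in> reach F" using reach by simp
      then show False using True nwx by (auto simp: doubleton_eq_iff dest: reach_sym)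
    next
      case False
      then have pqF: "{p, q} \<in> F" using pq by simp
      have sub: "F - {{p, q}} \<subseteq> F" by blast
      have "(p, q) \<in> reach (insert {w, x} (F - {{p, q}}))"
        using reach False by (simp add: insert_Diff_if)
      then show False
      proof (rule reach_insertE)
        assume "(p, q) \<in> reach (F - {{p, q}})"
        then have "(p, q) \<in> reach (T - {{p, q}})"
          by (rule reach_mono[rotated]) (auto simp: F_def)
        then show False using edge_tree_bridge[OF T(1)] pqF by (auto simp: F_def)
      next
        assume "(p, w) \<in> reach (F - {{p, q}})" "(x, q) \<in> reach (F - {{p, q}})"
        then have "(p, w) \<in> reach F" "(x, q) \<in> reach F"
          using reach_mono[OF sub] by auto
        then show False using nwx reach_edge[OF pqF] by (meson reach_sym reach_trans)
      next
        assume "(p, x) \<in> reach (F - {{p, q}})" "(w, q) \<in> reach (F - {{p, q}})"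
        then have "(p, x) \<in> reach F" "(w, q) \<in> reach F"
          using reach_mono[OF sub] by auto
        then show False using nwx reach_edge[OF pqF] by (meson reach_sym reach_trans)
      qed
    qed
  qed
  show "edge_tree V (insert {w, x} (T - {{a, b}}))"
    unfolding edge_tree_def F_def[symmetric]
    using conn bridge by (meson reach_sym reach_trans)
qed

text \<open>\<open>crossing_trees V E w x a b\<close> consists of the trees whose path from \<open>a\<close> to \<open>b\<close> traverses the edge
from \<open>w\<close> to \<open>x\<close>.  With the pairs interchanged, the same construction records on which sides of the
edge \<open>ab\<close> the vertices \<open>w\<close> and \<open>x\<close> lie.\<close>

definition crossing_trees :: "'a set \<Rightarrow> 'a set set \<Rightarrow> 'a \<Rightarrow> 'a \<Rightarrow> 'a \<Rightarrow> 'a \<Rightarrow> 'a set set set" where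
  "crossing_trees V E a b w x = {T \<in> trees V E. {a, b} \<in> T \<and>
     (a, w) \<in> reach (T - {{a, b}}) \<and> (b, x) \<in> reach (T - {{a, b}})}"

text \<open>Exchanging \<open>ab\<close> for \<open>wx\<close> keeps the two components and is undone by exchanging back.  This is the
reciprocity behind Kirchhoff's theorem: the left side counts positions of \<open>w\<close> and \<open>x\<close> relative to
the edge \<open>ab\<close>, the right side counts tree paths from \<open>a\<close> to \<open>b\<close> that use \<open>wx\<close>.\<close>

lemma card_crossing_trees_swap:
  assumes "{a, b} \<in> E" "{w, x} \<in> E" "a \<in> V" "w \<in> V"
  shows "card (crossing_trees V E a b w x) = card (crossing_trees V E w x a b)"
proof -
  have into: "insert {w, x} (T - {{a, b}}) \<in> crossing_trees V E w x a b \<and>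
      insert {a, b} (insert {w, x} (T - {{a, b}}) - {{w, x}}) = T"
    if T: "T \<in> crossing_trees V E a b w x" and "{a, b} \<in> E" "{w, x} \<in> E" "a \<in> V"
    for a b w x :: 'a and T
  proof -
    have T: "edge_tree V T" "T \<subseteq> E" "{a, b} \<in> T"
        "(a, w) \<in> reach (T - {{a, b}})" "(b, x) \<in> reach (T - {{a, b}})"
      using T by (auto simp: crossing_trees_def trees_def)
    note ex = edge_tree_exchange[OF T(1,3) \<open>a \<in> V\<close> T(4,5)]
    have "insert {w, x} (T - {{a, b}}) - {{w, x}} = T - {{a, b}}"
      using ex(2) by auto
    then show ?thesis
      using ex that T by (auto simp: crossing_trees_def trees_def intro: reach_sym)
  qed
  show ?thesis
    by (rule bij_betw_same_card[OF bij_betw_byWitness[where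
          f = "\<lambda>T. insert {w, x} (T - {{a, b}})" and f' = "\<lambda>T. insert {a, b} (T - {{w, x}})"]])
       (use into[where a = a and b = b and w = w and x = x]
          into[where a = w and b = x and w = a and x = b] assms in auto)
qed

section \<open>Kirchhoff's theorem\<close>

definition nbrs :: "'a set set \<Rightarrow> 'a \<Rightarrow> 'a set" where
  "nbrs E w = {x. {w, x} \<in> E}"

text \<open>The combinatorial Laplacian, that is, the net current out of \<open>w\<close> at voltages \<open>f\<close> and unit
conductances.\<close>

definition lap :: "'a set set \<Rightarrow> ('a \<Rightarrow> real) \<Rightarrow> 'a \<Rightarrow> real" where
  "lap E f w = (\<Sum>x\<in>nbrs E w. f w - f x)"

lemma finite_simple_subset:
  "finite_simple_ugraph (V, E) \<Longrightarrow> F \<subseteq> E \<Longrightarrow> finite_simple_ugraph (V, F)"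
  by (auto simp: finite_simple_ugraph_def)

lemma finite_simple_edgeD:
  assumes "finite_simple_ugraph (V, E)" "{u, v} \<in> E"
  shows "u \<in> V" "v \<in> V" "u \<noteq> v"
  using assms by (fastforce simp: finite_simple_ugraph_def)+

lemma nbrs_subset: "finite_simple_ugraph (V, E) \<Longrightarrow> nbrs E w \<subseteq> V"
  by (auto simp: nbrs_def dest: finite_simple_edgeD)

lemma finite_nbrs: "finite_simple_ugraph (V, E) \<Longrightarrow> finite (nbrs E w)"
  using nbrs_subset[of V E w] by (auto simp: finite_simple_ugraph_def intro: finite_subset)

lemma finite_trees:
  assumes "finite_simple_ugraph (V, E)"
  shows "finite (trees V E)"
proof -
  have "E \<subseteq> Pow V" "finite V" using assms by (auto simp: finite_simple_ugraph_def)
  then have "finite E" by (auto intro: finite_subset)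
  then show ?thesis by (auto simp: trees_def intro: finite_subset[of _ "Pow E"])
qed

lemma card_filter_eq_sum:
  "finite S \<Longrightarrow> real (card {x \<in> S. P x}) = (\<Sum>x\<in>S. of_bool (P x))"
  by (simp add: sum_of_bool_eq Collect_conj_eq)

text \<open>The path of the tree from \<open>w\<close> to another vertex \<open>b\<close> has exactly one first edge \<open>wx\<close>, and this is
the only edge at \<open>w\<close> whose far side contains \<open>b\<close>.  It is what makes each tree carry a flow that is
conserved at \<open>w\<close>.\<close>

lemma edge_tree_first_step:
  assumes T: "edge_tree V T" and "w \<in> V" "b \<in> V"
  shows "card {x \<in> nbrs T w. (x, b) \<in> reach (T - {{w, x}})} = of_bool (b \<noteq> w)"
proof (cases "b = w")
  case True
  then have empty: "{x \<in> nbrs T w. (x, b) \<in> reach (T - {{w, x}})} = {}"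
    using edge_tree_bridge[OF T] by (auto simp: nbrs_def dest: reach_sym)
  show ?thesis unfolding empty using True by simp
next
  case False
  have "(w, b) \<in> reach T" using assms by (auto simp: edge_tree_def)
  then have "b = w \<or> (\<exists>x\<in>nbrs T w. (x, b) \<in> reach (T - {{w, x}}))"
  proof (rule reach_invariant)
    fix y z
    assume yz: "{y, z} \<in> T" and "y = w \<or> (\<exists>x\<in>nbrs T w. (x, y) \<in> reach (T - {{w, x}}))"
    then consider "y = w" | x where "x \<in> nbrs T w" "(x, y) \<in> reach (T - {{w, x}})" by blast
    then show "z = w \<or> (\<exists>x\<in>nbrs T w. (x, z) \<in> reach (T - {{w, x}}))"
    proof cases
      case 1
      then show ?thesis using yz by (auto simp: nbrs_def intro!: bexI[of _ z])
    next
      case (2 x)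
      show ?thesis
      proof (cases "{y, z} = {w, x}")
        case True
        then consider "z = w" | "z = x" by (auto simp: doubleton_eq_iff)
        then show ?thesis by cases (use 2 in \<open>auto intro!: bexI[of _ x]\<close>)
      next
        case False
        then have "(y, z) \<in> reach (T - {{w, x}})" using yz by (intro reach_edge) auto
        then show ?thesis using 2 by (meson reach_trans)
      qed
    qed
  qed simp
  then obtain x where x: "x \<in> nbrs T w" "(x, b) \<in> reach (T - {{w, x}})"
    using False by blast
  \<comment> \<open>The far side of \<open>wx\<close> does not contain \<open>w\<close>, so reaching \<open>b\<close> inside it uses no other edge at \<open>w\<close>.\<close>
  have away: "(x, b) \<in> reach (T - {{w, x}, {w, x'}})"
    if "x \<in> nbrs T w" "x' \<in> nbrs T w" "x \<noteq> x'" "(x, b) \<in> reach (T - {{w, x}})" for x x'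
  proof -
    have sub: "T - {{w, x}, {w, x'}} \<subseteq> T - {{w, x}}" by blast
    have wx': "(w, x') \<in> reach (T - {{w, x}})"
      using that by (intro reach_edge) (auto simp: nbrs_def doubleton_eq_iff)
    have bridge: "(w, x) \<notin> reach (T - {{w, x}})"
      using edge_tree_bridge[OF T] that by (simp add: nbrs_def)
    have "T - {{w, x}} = insert {w, x'} (T - {{w, x}, {w, x'}})"
      using that by (auto simp: nbrs_def doubleton_eq_iff)
    then have "(x, b) \<in> reach (insert {w, x'} (T - {{w, x}, {w, x'}}))"
      using that by simp
    then show ?thesis
    proof (rule reach_insertE)
      assume "(x, w) \<in> reach (T - {{w, x}, {w, x'}})"
      from reach_mono[OF sub this] bridge show ?thesis by (meson reach_sym)
    next
      assume "(x, x') \<in> reach (T - {{w, x}, {w, x'}})"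
      from reach_mono[OF sub this] wx' bridge show ?thesis by (meson reach_sym reach_trans)
    qed
  qed
  have "x' = x" if x': "x' \<in> nbrs T w" "(x', b) \<in> reach (T - {{w, x'}})" for x'
  proof (rule ccontr)
    assume "x' \<noteq> x"
    have "(x, b) \<in> reach (T - {{w, x}, {w, x'}})"
      using away[of x x'] x x' \<open>x' \<noteq> x\<close> by simp
    moreover have "(x', b) \<in> reach (T - {{w, x}, {w, x'}})"
      using away[of x' x] x x' \<open>x' \<noteq> x\<close> by (simp add: insert_commute)
    ultimately have "(x, x') \<in> reach (T - {{w, x}, {w, x'}})"
      by (meson reach_sym reach_trans)
    then have "(x, x') \<in> reach (T - {{w, x}})"
      by (rule reach_mono[rotated]) blast
    moreover have "(w, x') \<in> reach (T - {{w, x}})"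
      using x' \<open>x' \<noteq> x\<close> by (intro reach_edge) (auto simp: nbrs_def doubleton_eq_iff)
    ultimately have "(w, x) \<in> reach (T - {{w, x}})"
      by (meson reach_sym reach_trans)
    then show False using edge_tree_bridge[OF T] x by (simp add: nbrs_def)
  qed
  then have "{x \<in> nbrs T w. (x, b) \<in> reach (T - {{w, x}})} = {x}" using x by blast
  then show ?thesis using False by simp
qed

text \<open>Up to the factor \<open>\<tau>\<close>, this turns out to be the voltage at \<open>w\<close> when a unit current enters at \<open>a\<close> and
leaves at \<open>b\<close>, normalised to vanish at \<open>b\<close>.\<close>

definition side_count :: "'a set \<Rightarrow> 'a set set \<Rightarrow> 'a \<Rightarrow> 'a \<Rightarrow> 'a \<Rightarrow> real" where
  "side_count V E a b w =
     real (card {T \<in> trees V E. {a, b} \<in> T \<and> (a, w) \<in> reach (T - {{a, b}})})"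

text \<open>A tree with \<open>w\<close> and \<open>x\<close> on the same side of \<open>ab\<close> contributes equally to both counts.\<close>

lemma side_count_diff:
  assumes "finite_simple_ugraph (V, E)" "a \<in> V" "w \<in> V" "x \<in> V"
  shows "side_count V E a b w - side_count V E a b x =
    real (card (crossing_trees V E a b w x)) - real (card (crossing_trees V E a b x w))"
proof -
  have "of_bool ({a, b} \<in> T \<and> (a, w) \<in> reach (T - {{a, b}})) -
      of_bool ({a, b} \<in> T \<and> (a, x) \<in> reach (T - {{a, b}})) =
      (of_bool ({a, b} \<in> T \<and> (a, w) \<in> reach (T - {{a, b}}) \<and> (b, x) \<in> reach (T - {{a, b}})) -
      of_bool ({a, b} \<in> T \<and> (a, x) \<in> reach (T - {{a, b}}) \<and> (b, w) \<in> reach (T - {{a, b}})) :: real)"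
    if "T \<in> trees V E" for T
    using edge_tree_sides[of V T a b w] edge_tree_sides[of V T a b x] that assms
    by (cases "{a, b} \<in> T") (auto simp: trees_def)
  then show ?thesis
    unfolding side_count_def crossing_trees_def card_filter_eq_sum[OF finite_trees[OF assms(1)]]
      sum_subtractf[symmetric]
    by (rule sum.cong[OF refl])
qed

text \<open>Kirchhoff's node law.  By reciprocity, the voltage difference along \<open>wx\<close> is the number of trees
whose path from \<open>a\<close> to \<open>b\<close> traverses \<open>wx\<close> forwards, minus the number of those traversing it
backwards.  Summed over the neighbours of \<open>w\<close>, each single tree contributes the net number of times
its path leaves \<open>w\<close>, which is \<open>1\<close> at \<open>a\<close>, \<open>-1\<close> at \<open>b\<close> and \<open>0\<close> elsewhere.\<close>

lemma lap_side_count: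
  assumes G: "finite_simple_ugraph (V, E)" and ab: "{a, b} \<in> E" and w: "w \<in> V"
  shows "lap E (side_count V E a b) w =
    real (card (trees V E)) * (of_bool (w = a) - of_bool (w = b))"
proof -
  have abV: "a \<in> V" "b \<in> V" using finite_simple_edgeD[OF G ab] by auto
  have fin: "finite (trees V E)" "finite (nbrs E w)"
    using finite_trees[OF G] finite_nbrs[OF G] by auto
  \<comment> \<open>\<open>?B T x c\<close>: the path of \<open>T\<close> from \<open>w\<close> to \<open>c\<close> starts with the edge \<open>wx\<close>.\<close>
  let ?B = "\<lambda>T x c. x \<in> nbrs T w \<and> (x, c) \<in> reach (T - {{w, x}})"
  have per_tree: "(\<Sum>x\<in>nbrs E w. of_bool (?B T x c)) = (of_bool (c \<noteq> w) :: real)"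
    if "T \<in> trees V E" "c \<in> V" for T c
  proof -
    have "{x \<in> nbrs E w. ?B T x c} = {x \<in> nbrs T w. (x, c) \<in> reach (T - {{w, x}})}"
      using that by (auto simp: trees_def nbrs_def)
    then have "card {x \<in> nbrs E w. ?B T x c} = of_bool (c \<noteq> w)"
      using edge_tree_first_step[of V T w c] that w by (simp add: trees_def)
    then show ?thesis
      unfolding card_filter_eq_sum[OF fin(2), symmetric] by simp
  qed
  have "lap E (side_count V E a b) w =
      (\<Sum>x\<in>nbrs E w. \<Sum>T\<in>trees V E. of_bool (?B T x b) - of_bool (?B T x a))"
    unfolding lap_def
  proof (rule sum.cong[OF refl])
    fix x assume "x \<in> nbrs E w"
    then have wx: "{w, x} \<in> E" and xV: "x \<in> V"
      using nbrs_subset[OF G] by (auto simp: nbrs_def)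
    have "side_count V E a b w - side_count V E a b x =
        real (card (crossing_trees V E w x a b)) - real (card (crossing_trees V E x w a b))"
      using side_count_diff[OF G abV(1) w xV, of b]
        card_crossing_trees_swap[OF ab wx abV(1) w]
        card_crossing_trees_swap[of a b E x w V, OF ab _ abV(1) xV] wx
      by (simp add: insert_commute)
    also have "\<dots> = (\<Sum>T\<in>trees V E.
        of_bool ({w, x} \<in> T \<and> (w, a) \<in> reach (T - {{w, x}}) \<and> (x, b) \<in> reach (T - {{w, x}})) -
        of_bool ({x, w} \<in> T \<and> (x, a) \<in> reach (T - {{x, w}}) \<and> (w, b) \<in> reach (T - {{x, w}})))"
      unfolding crossing_trees_def card_filter_eq_sum[OF fin(1)] sum_subtractf ..
    also have "\<dots> = (\<Sum>T\<in>trees V E. of_bool (?B T x b) - of_bool (?B T x a))"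
    proof (rule sum.cong[OF refl])
      fix T assume "T \<in> trees V E"
      then show "(of_bool ({w, x} \<in> T \<and> (w, a) \<in> reach (T - {{w, x}}) \<and> (x, b) \<in> reach (T - {{w, x}})) -
        of_bool ({x, w} \<in> T \<and> (x, a) \<in> reach (T - {{x, w}}) \<and> (w, b) \<in> reach (T - {{x, w}})) :: real) =
        of_bool (?B T x b) - of_bool (?B T x a)"
        using edge_tree_sides[of V T w x a] edge_tree_sides[of V T w x b] w abV
        by (cases "{w, x} \<in> T") (auto simp: trees_def nbrs_def insert_commute)
    qed
    finally show "side_count V E a b w - side_count V E a b x =
        (\<Sum>T\<in>trees V E. of_bool (?B T x b) - of_bool (?B T x a))" .
  qed
  also have "\<dots> = (\<Sum>T\<in>trees V E.
      (\<Sum>x\<in>nbrs E w. of_bool (?B T x b)) - (\<Sum>x\<in>nbrs E w. of_bool (?B T x a)))"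
    by (subst sum.swap) (simp only: sum_subtractf)
  also have "\<dots> = (\<Sum>T\<in>trees V E. of_bool (w = a) - of_bool (w = b))"
    by (intro sum.cong refl) (use per_tree abV in auto)
  finally show ?thesis by simp
qed

text \<open>The maximum principle: a harmonic function that is maximal at a vertex takes the same value at all
its neighbours.\<close>

lemma lap_zero_imp_eq:
  assumes G: "finite_simple_ugraph (V, E)" and conn: "\<And>u v. u \<in> V \<Longrightarrow> v \<in> V \<Longrightarrow> (u, v) \<in> reach E"
    and harm: "\<And>w. w \<in> V \<Longrightarrow> lap E g w = 0" and ab: "a \<in> V" "b \<in> V"
  shows "g a = g b"
proof -
  have "finite V" using G by (auto simp: finite_simple_ugraph_def)
  define M where "M = Max (g ` V)"
  have le: "g v \<le> M" if "v \<in> V" for v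
    using that \<open>finite V\<close> by (auto simp: M_def)
  have "M \<in> g ` V"
    unfolding M_def using \<open>finite V\<close> ab by (intro Max_in) auto
  then obtain m where m: "m \<in> V" "g m = M" by auto
  have "v \<in> V \<and> g v = M" if "v \<in> V" for v
    using conn[OF m(1) that]
  proof (rule reach_invariant)
    fix u v assume uv: "{u, v} \<in> E" and u: "u \<in> V \<and> g u = M"
    have "v \<in> nbrs E u" using uv by (simp add: nbrs_def)
    moreover have "(\<Sum>x\<in>nbrs E u. g u - g x) = 0"
      using harm[of u] u unfolding lap_def by blast
    moreover have "\<forall>x\<in>nbrs E u. 0 \<le> g u - g x"
      using u le nbrs_subset[OF G] by fastforce
    ultimately have "g u - g v = 0"
      using sum_nonneg_eq_0_iff[OF finite_nbrs[OF G], of u "\<lambda>x. g u - g x"] by auto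
    then show "v \<in> V \<and> g v = M"
      using u finite_simple_edgeD[OF G uv] by simp
  qed (use m in simp)
  then show ?thesis using ab by simp
qed

text \<open>The function \<open>f\<close> gives voltages under which a unit current flows from \<open>a\<close> to \<open>b\<close>.\<close>

definition potential :: "'a set \<Rightarrow> 'a set set \<Rightarrow> 'a \<Rightarrow> 'a \<Rightarrow> ('a \<Rightarrow> real) \<Rightarrow> bool" where
  "potential V E a b f \<longleftrightarrow> (\<forall>w\<in>V. lap E f w = of_bool (w = a) - of_bool (w = b))"

lemma lap_diff_scale: "lap E (\<lambda>w. f w - c * g w) w = lap E f w - c * lap E g w"
  unfolding lap_def by (simp add: sum_distrib_left algebra_simps flip: sum_subtractf)

lemma lap_diff: "lap E (\<lambda>w. f w - g w) w = lap E f w - lap E g w"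
  using lap_diff_scale[of E f 1 g w] by simp

text \<open>Kirchhoff's theorem.  Both \<open>side_count\<close> and \<open>\<tau> f\<close> have the same Laplacian, so they differ by a
constant, and \<open>side_count\<close> falls from the number of trees containing \<open>ab\<close> at \<open>a\<close> to \<open>0\<close> at \<open>b\<close>.
A disconnected graph satisfies the identity with both sides zero.\<close>

lemma card_trees_containing_edge:
  assumes G: "finite_simple_ugraph (V, E)" and ab: "{a, b} \<in> E" and f: "potential V E a b f"
  shows "real (card {T \<in> trees V E. {a, b} \<in> T}) = real (card (trees V E)) * (f a - f b)"
proof (cases "trees V E = {}")
  case False
  then obtain T where T: "T \<subseteq> E" "edge_tree V T" by (auto simp: trees_def)
  have conn: "(u, v) \<in> reach E" if "u \<in> V" "v \<in> V" for u v
    using reach_mono[OF T(1), of u v] T(2) that by (simp add: edge_tree_def)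
  note abV = finite_simple_edgeD(1,2)[OF G ab]
  define g where "g = (\<lambda>w. side_count V E a b w - real (card (trees V E)) * f w)"
  have "g a = g b"
    by (rule lap_zero_imp_eq[OF G conn _ abV])
       (use f in \<open>auto simp: g_def lap_diff_scale lap_side_count[OF G ab] potential_def\<close>)
  moreover have "side_count V E a b a = real (card {T \<in> trees V E. {a, b} \<in> T})"
    by (simp add: side_count_def)
  moreover have "{T \<in> trees V E. {a, b} \<in> T \<and> (a, b) \<in> reach (T - {{a, b}})} = {}"
    by (auto simp: trees_def dest: edge_tree_bridge)
  then have "side_count V E a b b = 0"
    by (simp only: side_count_def card.empty)
  ultimately show ?thesis by (simp add: g_def algebra_simps)
qed simp

lemma card_trees_delete_edge:
  assumes G: "finite_simple_ugraph (V, E)" and ab: "{a, b} \<in> E" and f: "potential V E a b f"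
  shows "real (card (trees V (E - {{a, b}}))) = real (card (trees V E)) * (1 - (f a - f b))"
proof -
  have "trees V (E - {{a, b}}) \<inter> {T \<in> trees V E. {a, b} \<in> T} = {}"
    by (auto simp: trees_def)
  moreover have "finite (trees V (E - {{a, b}}))" "finite {T \<in> trees V E. {a, b} \<in> T}"
    using finite_trees[OF G] finite_trees[OF finite_simple_subset[OF G, of "E - {{a, b}}"]]
    by auto
  ultimately have "card (trees V (E - {{a, b}}) \<union> {T \<in> trees V E. {a, b} \<in> T}) =
      card (trees V (E - {{a, b}})) + card {T \<in> trees V E. {a, b} \<in> T}"
    by (intro card_Un_disjoint)
  moreover have "trees V (E - {{a, b}}) \<union> {T \<in> trees V E. {a, b} \<in> T} = trees V E"
    by (auto simp: trees_def)
  ultimately have "real (card (trees V E)) =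
      real (card (trees V (E - {{a, b}}))) + real (card {T \<in> trees V E. {a, b} \<in> T})"
    by (metis of_nat_add)
  then show ?thesis
    using card_trees_containing_edge[OF assms] unfolding right_diff_distrib[of _ 1] by linarith
qed

lemma lap_delete_edge:
  assumes G: "finite_simple_ugraph (V, E)" and ab: "{a, b} \<in> E"
  shows "lap (E - {{a, b}}) f w = lap E f w - (f a - f b) * (of_bool (w = a) - of_bool (w = b))"
proof -
  have "a \<noteq> b" using finite_simple_edgeD[OF G ab] by simp
  have remove: "lap (E - {{a, b}}) f w = lap E f w - (f w - f c)"
    if "nbrs (E - {{a, b}}) w = nbrs E w - {c}" "c \<in> nbrs E w" for c
    unfolding lap_def that(1) using that(2) finite_nbrs[OF G] by (simp add: sum_diff1)
  consider "w = a" | "w = b" | "w \<noteq> a" "w \<noteq> b" by blast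
  then show ?thesis
  proof cases
    case 1
    then have "nbrs (E - {{a, b}}) w = nbrs E w - {b}" "b \<in> nbrs E w"
      using ab \<open>a \<noteq> b\<close> by (auto simp: nbrs_def doubleton_eq_iff)
    then show ?thesis using remove[of b] 1 \<open>a \<noteq> b\<close> by simp
  next
    case 2
    then have "nbrs (E - {{a, b}}) w = nbrs E w - {a}" "a \<in> nbrs E w"
      using ab \<open>a \<noteq> b\<close> by (auto simp: nbrs_def doubleton_eq_iff insert_commute)
    then show ?thesis using remove[of a] 2 \<open>a \<noteq> b\<close> by simp
  next
    case 3
    then have "nbrs (E - {{a, b}}) w = nbrs E w"
      by (auto simp: nbrs_def doubleton_eq_iff)
    then show ?thesis using 3 by (simp add: lap_def)
  qed
qed

text \<open>A rank-one update.  Deleting \<open>ab\<close> removes the current that \<open>g\<close> sent through it; a suitable multiple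
of \<open>f\<close> supplies this current along other routes.  The denominator vanishes only for voltages at
which all the current from \<open>a\<close> to \<open>b\<close> uses the edge itself.\<close>

lemma potential_delete_edge:
  assumes G: "finite_simple_ugraph (V, E)" and ab: "{a, b} \<in> E"
    and f: "potential V E a b f" and g: "potential V E c d g" and "f a - f b \<noteq> 1"
  shows "potential V (E - {{a, b}}) c d (\<lambda>w. g w + (g a - g b) / (1 - (f a - f b)) * f w)"
  unfolding potential_def
proof
  fix w assume "w \<in> V"
  define k where "k = (g a - g b) / (1 - (f a - f b))"
  have "k * (1 - (f a - f b)) = g a - g b"
    using assms(5) by (simp add: k_def)
  then have k: "g a - g b = k - k * (f a - f b)" by (simp add: algebra_simps)
  have "lap (E - {{a, b}}) (\<lambda>w. g w + k * f w) w =
      lap E (\<lambda>w. g w - (- k) * f w) w - (g a - g b + k * (f a - f b)) * (of_bool (w = a) - of_bool (w = b))"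
    using lap_delete_edge[OF G ab, of "\<lambda>w. g w + k * f w"] by (simp add: algebra_simps)
  also have "\<dots> = lap E g w + k * lap E f w - k * (of_bool (w = a) - of_bool (w = b))"
    unfolding lap_diff_scale k by (simp add: algebra_simps)
  also have "\<dots> = of_bool (w = c) - of_bool (w = d)"
    using f g \<open>w \<in> V\<close> by (simp add: potential_def)
  finally show "lap (E - {{a, b}}) (\<lambda>w. g w + (g a - g b) / (1 - (f a - f b)) * f w) w =
      of_bool (w = c) - of_bool (w = d)" by (simp add: k_def)
qed

section \<open>Deleting three edges at a vertex\<close>

definition det3 :: "real \<Rightarrow> real \<Rightarrow> real \<Rightarrow> real \<Rightarrow> real \<Rightarrow> real \<Rightarrow> real \<Rightarrow> real \<Rightarrow> real \<Rightarrow> real" where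
  "det3 a b c d e f g h i = a * (e * i - f * h) - b * (d * i - f * g) + c * (d * h - e * g)"

text \<open>Gaussian elimination of the first row and column.\<close>

lemma det3_condense:
  assumes "a \<noteq> 0" "e' = e - d / a * b" "f' = f - d / a * c" "h' = h - g / a * b" "i' = i - g / a * c"
  shows "det3 a b c d e f g h i = a * (e' * i' - f' * h')"
  using assms(1) unfolding assms(2-) det3_def by (simp add: field_simps)

text \<open>With \<open>K i j = f i v - f i (x j)\<close> the matrix is \<open>I - K\<close>.  Each deletion contributes the factor
\<open>1 - K i i\<close> and replaces the remaining entries by those of a Schur complement, exactly as Gaussian
elimination does; the two inequalities say that the first two pivots do not vanish.\<close>

lemma card_trees_delete_three_edges:
  fixes V :: "'a set"
  assumes G: "finite_simple_ugraph (V, E)"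
    and edges: "{v, x\<^sub>1} \<in> E" "{v, x\<^sub>2} \<in> E" "{v, x\<^sub>3} \<in> E" "x\<^sub>1 \<noteq> x\<^sub>2" "x\<^sub>1 \<noteq> x\<^sub>3" "x\<^sub>2 \<noteq> x\<^sub>3"
    and pot: "potential V E v x\<^sub>1 f\<^sub>1" "potential V E v x\<^sub>2 f\<^sub>2" "potential V E v x\<^sub>3 f\<^sub>3"
    and nz1: "f\<^sub>1 v - f\<^sub>1 x\<^sub>1 \<noteq> 1"
    and nz2: "(1 - (f\<^sub>1 v - f\<^sub>1 x\<^sub>1)) * (1 - (f\<^sub>2 v - f\<^sub>2 x\<^sub>2)) \<noteq> (f\<^sub>1 v - f\<^sub>1 x\<^sub>2) * (f\<^sub>2 v - f\<^sub>2 x\<^sub>1)"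
  shows "real (card (trees V (E - {{v, x\<^sub>1}, {v, x\<^sub>2}, {v, x\<^sub>3}}))) = real (card (trees V E)) *
    det3 (1 - (f\<^sub>1 v - f\<^sub>1 x\<^sub>1)) (- (f\<^sub>1 v - f\<^sub>1 x\<^sub>2)) (- (f\<^sub>1 v - f\<^sub>1 x\<^sub>3))
      (- (f\<^sub>2 v - f\<^sub>2 x\<^sub>1)) (1 - (f\<^sub>2 v - f\<^sub>2 x\<^sub>2)) (- (f\<^sub>2 v - f\<^sub>2 x\<^sub>3))
      (- (f\<^sub>3 v - f\<^sub>3 x\<^sub>1)) (- (f\<^sub>3 v - f\<^sub>3 x\<^sub>2)) (1 - (f\<^sub>3 v - f\<^sub>3 x\<^sub>3))"
proof -
  define E1 where "E1 = E - {{v, x\<^sub>1}}"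
  define E2 where "E2 = E1 - {{v, x\<^sub>2}}"
  have G1: "finite_simple_ugraph (V, E1)" and G2: "finite_simple_ugraph (V, E2)"
    by (rule finite_simple_subset[OF G]; auto simp: E1_def E2_def)+
  have edges': "{v, x\<^sub>2} \<in> E1" "{v, x\<^sub>3} \<in> E2"
    using edges by (auto simp: E1_def E2_def doubleton_eq_iff)
  define c where "c = 1 - (f\<^sub>1 v - f\<^sub>1 x\<^sub>1)"
  have "c \<noteq> 0" using nz1 by (simp add: c_def)
  define g\<^sub>2 where "g\<^sub>2 = (\<lambda>w. f\<^sub>2 w + (f\<^sub>2 v - f\<^sub>2 x\<^sub>1) / c * f\<^sub>1 w)"
  define g\<^sub>3 where "g\<^sub>3 = (\<lambda>w. f\<^sub>3 w + (f\<^sub>3 v - f\<^sub>3 x\<^sub>1) / c * f\<^sub>1 w)"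
  have pot1: "potential V E1 v x\<^sub>2 g\<^sub>2" "potential V E1 v x\<^sub>3 g\<^sub>3"
    unfolding E1_def g\<^sub>2_def g\<^sub>3_def c_def
    using potential_delete_edge[OF G edges(1) pot(1) _ nz1] pot by blast+
  define d where "d = 1 - (g\<^sub>2 v - g\<^sub>2 x\<^sub>2)"
  have cd: "c * d = c * (1 - (f\<^sub>2 v - f\<^sub>2 x\<^sub>2)) - (f\<^sub>1 v - f\<^sub>1 x\<^sub>2) * (f\<^sub>2 v - f\<^sub>2 x\<^sub>1)"
    using \<open>c \<noteq> 0\<close> unfolding d_def g\<^sub>2_def by (simp add: field_simps)
  then have "d \<noteq> 0" using nz2 \<open>c \<noteq> 0\<close> unfolding c_def[symmetric] by auto
  then have nz1': "g\<^sub>2 v - g\<^sub>2 x\<^sub>2 \<noteq> 1" by (auto simp: d_def)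
  define h where "h = (\<lambda>w. g\<^sub>3 w + (g\<^sub>3 v - g\<^sub>3 x\<^sub>2) / d * g\<^sub>2 w)"
  have pot2: "potential V E2 v x\<^sub>3 h"
    unfolding E2_def h_def d_def by (rule potential_delete_edge[OF G1 edges'(1) pot1 nz1'])
  have "E - {{v, x\<^sub>1}, {v, x\<^sub>2}, {v, x\<^sub>3}} = E2 - {{v, x\<^sub>3}}"
    by (auto simp: E1_def E2_def)
  then have "real (card (trees V (E - {{v, x\<^sub>1}, {v, x\<^sub>2}, {v, x\<^sub>3}}))) =
      real (card (trees V E)) * (c * (d * (1 - (h v - h x\<^sub>3))))"
    using card_trees_delete_edge[OF G edges(1) pot(1)] card_trees_delete_edge[OF G1 edges'(1) pot1(1)]
      card_trees_delete_edge[OF G2 edges'(2) pot2]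
    by (simp add: E1_def[symmetric] E2_def[symmetric] c_def d_def)
  also have "d * (1 - (h v - h x\<^sub>3)) =
      d * (1 - (g\<^sub>3 v - g\<^sub>3 x\<^sub>3)) - (- (g\<^sub>2 v - g\<^sub>2 x\<^sub>3)) * (- (g\<^sub>3 v - g\<^sub>3 x\<^sub>2))"
    using \<open>d \<noteq> 0\<close> unfolding h_def by (simp add: field_simps)
  also have "c * \<dots> = det3 c (- (f\<^sub>1 v - f\<^sub>1 x\<^sub>2)) (- (f\<^sub>1 v - f\<^sub>1 x\<^sub>3))
      (- (f\<^sub>2 v - f\<^sub>2 x\<^sub>1)) (1 - (f\<^sub>2 v - f\<^sub>2 x\<^sub>2)) (- (f\<^sub>2 v - f\<^sub>2 x\<^sub>3))
      (- (f\<^sub>3 v - f\<^sub>3 x\<^sub>1)) (- (f\<^sub>3 v - f\<^sub>3 x\<^sub>2)) (1 - (f\<^sub>3 v - f\<^sub>3 x\<^sub>3))"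
    by (rule det3_condense[OF \<open>c \<noteq> 0\<close>, symmetric])
       (use \<open>c \<noteq> 0\<close> in \<open>simp_all add: d_def g\<^sub>2_def g\<^sub>3_def field_simps\<close>)
  finally show ?thesis by (simp only: c_def)
qed

section \<open>Leaves of spanning trees\<close>

definition pendant_trees :: "'a set \<Rightarrow> 'a set set \<Rightarrow> 'a \<Rightarrow> 'a \<Rightarrow> 'a set set set" where
  "pendant_trees V E v x = {T \<in> trees V E. nbrs T v = {x}}"

text \<open>A leaf can be reattached to any other of its neighbours, since deleting its edge isolates it.\<close>

lemma card_pendant_trees_eq:
  assumes G: "finite_simple_ugraph (V, E)" and "x \<in> nbrs E v" "y \<in> nbrs E v"
  shows "card (pendant_trees V E v x) = card (pendant_trees V E v y)"
proof -
  have into: "insert {v, y} (T - {{v, x}}) \<in> pendant_trees V E v y \<and>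
      insert {v, x} (insert {v, y} (T - {{v, x}}) - {{v, y}}) = T"
    if T: "T \<in> pendant_trees V E v x" and y: "y \<in> nbrs E v" for T x y
  proof -
    have tree: "edge_tree V T" "T \<subseteq> E" and only: "\<And>z. {v, z} \<in> T \<longleftrightarrow> z = x"
      using T by (auto simp: pendant_trees_def trees_def nbrs_def)
    have vy: "{v, y} \<in> E" using y by (simp add: nbrs_def)
    note yV = finite_simple_edgeD[OF G vy]
    have vx: "{v, x} \<in> T" using only by simp
    have iso: "{v, z} \<notin> T - {{v, x}}" for z using only by auto
    have "(v, y) \<notin> reach (T - {{v, x}})"
    proof
      assume "(v, y) \<in> reach (T - {{v, x}})"
      then have "y = v" by (rule reach_invariant) (use iso in auto)
      then show False using yV by simp
    qed
    then have "(x, y) \<in> reach (T - {{v, x}})"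
      using edge_tree_sides[OF tree(1) vx yV(1,2)] by simp
    from edge_tree_exchange(1)[OF tree(1) vx yV(1) reach_refl this]
    have "edge_tree V (insert {v, y} (T - {{v, x}}))" .
    moreover have "nbrs (insert {v, y} (T - {{v, x}})) v = {y}"
      using iso by (auto simp: nbrs_def doubleton_eq_iff)
    moreover have "insert {v, y} (T - {{v, x}}) - {{v, y}} = T - {{v, x}}"
      using iso by auto
    ultimately show ?thesis
      using tree vy vx by (auto simp: pendant_trees_def trees_def)
  qed
  show ?thesis
    by (rule bij_betw_same_card[OF bij_betw_byWitness[where
          f = "\<lambda>T. insert {v, y} (T - {{v, x}})" and f' = "\<lambda>T. insert {v, x} (T - {{v, y}})"]])
       (use into[where x = x and y = y] into[where x = y and y = x] assms in auto)
qed

lemma card_incident_edges: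
  assumes "finite_simple_ugraph (V, T)"
  shows "card {e \<in> T. v \<in> e} = card (nbrs T v)"
proof -
  have "bij_betw (\<lambda>x. {v, x}) (nbrs T v) {e \<in> T. v \<in> e}"
  proof (rule bij_betwI')
    fix e assume e: "e \<in> {e \<in> T. v \<in> e}"
    then have "card e = 2" using assms by (auto simp: finite_simple_ugraph_def)
    then obtain p q where "e = {p, q}" by (auto simp: card_2_iff)
    then have "e = {v, if p = v then q else p}" using e by auto
    then show "\<exists>x\<in>nbrs T v. e = {v, x}" using e by (auto simp: nbrs_def)
  qed (auto simp: nbrs_def doubleton_eq_iff)
  then show ?thesis by (simp add: bij_betw_same_card)
qed

lemma card_leaf_trees:
  assumes G: "finite_simple_ugraph (V, E)" and x: "x \<in> nbrs E v"
  shows "card {T \<in> trees V E. card {e \<in> T. v \<in> e} = 1} =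
    card (nbrs E v) * card (pendant_trees V E v x)"
proof -
  have "{T \<in> trees V E. card {e \<in> T. v \<in> e} = 1} = (\<Union>y\<in>nbrs E v. pendant_trees V E v y)"
  proof (intro set_eqI)
    fix T
    show "T \<in> {T \<in> trees V E. card {e \<in> T. v \<in> e} = 1} \<longleftrightarrow>
        T \<in> (\<Union>y\<in>nbrs E v. pendant_trees V E v y)"
    proof (cases "T \<in> trees V E")
      case True
      then have "T \<subseteq> E" by (simp add: trees_def)
      have "T \<in> {T \<in> trees V E. card {e \<in> T. v \<in> e} = 1} \<longleftrightarrow> card (nbrs T v) = 1"
        using True card_incident_edges[OF finite_simple_subset[OF G \<open>T \<subseteq> E\<close>], of v] by simp
      also have "\<dots> \<longleftrightarrow> (\<exists>y. nbrs T v = {y})" by (simp add: card_1_singleton_iff)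
      also have "\<dots> \<longleftrightarrow> (\<exists>y\<in>nbrs E v. nbrs T v = {y})"
        using \<open>T \<subseteq> E\<close> by (auto simp: nbrs_def)
      also have "\<dots> \<longleftrightarrow> T \<in> (\<Union>y\<in>nbrs E v. pendant_trees V E v y)"
        using True by (simp add: pendant_trees_def)
      finally show ?thesis .
    qed (auto simp: pendant_trees_def)
  qed
  also have "card \<dots> = (\<Sum>y\<in>nbrs E v. card (pendant_trees V E v y))"
    by (rule card_UN_disjoint)
       (use finite_nbrs[OF G] finite_trees[OF G] in \<open>auto simp: pendant_trees_def\<close>)
  also have "\<dots> = (\<Sum>y\<in>nbrs E v. card (pendant_trees V E v x))"
    by (rule sum.cong[OF refl]) (rule card_pendant_trees_eq[OF G _ x])
  finally show ?thesis by simp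
qed

text \<open>A spanning tree must use some edge at \<open>v\<close>, so once all edges at \<open>v\<close> but one are deleted, \<open>v\<close> is a
leaf.  This reduces the count of leaves to edge deletions.\<close>

lemma pendant_trees_eq_trees:
  assumes G: "finite_simple_ugraph (V, E)" and x: "x \<in> nbrs E v"
  shows "pendant_trees V E v x = trees V (E - (\<lambda>y. {v, y}) ` (nbrs E v - {x}))"
proof (intro set_eqI iffI)
  fix T assume "T \<in> pendant_trees V E v x"
  then have T: "T \<in> trees V E" "\<And>y. {v, y} \<in> T \<longleftrightarrow> y = x"
    by (auto simp: pendant_trees_def nbrs_def)
  then show "T \<in> trees V (E - (\<lambda>y. {v, y}) ` (nbrs E v - {x}))"
    by (auto simp: trees_def)
next
  fix T assume T: "T \<in> trees V (E - (\<lambda>y. {v, y}) ` (nbrs E v - {x}))"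
  then have tree: "edge_tree V T" "T \<subseteq> E" by (auto simp: trees_def)
  have vx: "{v, x} \<in> E" using x by (simp add: nbrs_def)
  note xV = finite_simple_edgeD[OF G vx]
  have sub: "nbrs T v \<subseteq> {x}"
    using T by (auto simp: trees_def nbrs_def)
  have "card {y \<in> nbrs T v. (y, x) \<in> reach (T - {{v, y}})} = 1"
    using edge_tree_first_step[OF tree(1) xV(1,2)] xV(3) by simp
  then have "nbrs T v \<noteq> {}" by (auto simp: card_1_singleton_iff)
  then show "T \<in> pendant_trees V E v x"
    using sub tree by (auto simp: pendant_trees_def trees_def)
qed

lemma sum_leaves_eq:
  assumes G: "finite_simple_ugraph (V, E)" and "V \<noteq> {}"
  shows "real (\<Sum>T\<in>ugraph_spanning_trees (V, E). card (ugraph_leaves T)) =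
    (\<Sum>v\<in>V. real (card {T \<in> trees V E. card {e \<in> T. v \<in> e} = 1}))"
proof -
  have "finite V" using G by (simp add: finite_simple_ugraph_def)
  have inj: "inj_on (Pair V) (trees V E)" by (rule inj_onI) simp
  have "real (\<Sum>T\<in>ugraph_spanning_trees (V, E). card (ugraph_leaves T)) =
      (\<Sum>T\<in>trees V E. real (card {v \<in> V. card {e \<in> T. v \<in> e} = 1}))"
    unfolding spanning_trees_eq_trees[OF assms] sum.reindex[OF inj]
    by (simp add: ugraph_leaves_def ugraph_degree_def)
  also have "\<dots> = (\<Sum>v\<in>V. real (card {T \<in> trees V E. card {e \<in> T. v \<in> e} = 1}))"
    unfolding card_filter_eq_sum[OF \<open>finite V\<close>] card_filter_eq_sum[OF finite_trees[OF G]]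
    by (rule sum.swap)
  finally show ?thesis .
qed

lemma tau_eq_card_trees:
  assumes "finite_simple_ugraph (V, E)" "V \<noteq> {}"
  shows "ugraph_tau (V, E) = card (trees V E)"
  unfolding ugraph_tau_def spanning_trees_eq_trees[OF assms]
  by (rule card_image) (auto intro: inj_onI)

text \<open>A minimal connected edge set has only bridges.\<close>

lemma trees_nonempty:
  assumes G: "finite_simple_ugraph (V, E)" and conn: "\<And>u v. u \<in> V \<Longrightarrow> v \<in> V \<Longrightarrow> (u, v) \<in> reach E"
  shows "trees V E \<noteq> {}"
proof -
  have "E \<subseteq> Pow V" "finite V" using G by (auto simp: finite_simple_ugraph_def)
  then have "finite E" by (auto intro: finite_subset)
  define S where "S = {F. F \<subseteq> E \<and> (\<forall>u\<in>V. \<forall>v\<in>V. (u, v) \<in> reach F)}"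
  have "finite S" unfolding S_def using \<open>finite E\<close> by simp
  moreover have "S \<noteq> {}" using conn by (auto simp: S_def)
  ultimately obtain F where F: "F \<in> S" and min: "\<And>F'. F' \<in> S \<Longrightarrow> F' \<subseteq> F \<Longrightarrow> F = F'"
    using finite_has_minimal[of S] by blast
  have "(u, v) \<notin> reach (F - {{u, v}})" if uv: "{u, v} \<in> F" for u v
  proof
    assume reach: "(u, v) \<in> reach (F - {{u, v}})"
    have "(p, q) \<in> reach (F - {{u, v}})" if "p \<in> V" "q \<in> V" for p q
    proof -
      have "(p, q) \<in> reach (insert {u, v} (F - {{u, v}}))"
        using F that uv by (simp add: S_def insert_absorb)
      then show ?thesis
        by (rule reach_insertE) (use reach in \<open>meson reach_sym reach_trans\<close>)+
    qed
    then have "F - {{u, v}} \<in> S" using F by (auto simp: S_def)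
    from min[OF this] uv show False by blast
  qed
  then have "F \<in> trees V E" using F by (auto simp: S_def trees_def edge_tree_def)
  then show ?thesis by blast
qed

section \<open>Green functions on the cycle and on the torus\<close>

text \<open>The \<open>n\<close>-periodic extension of \<open>g\<close>.  Functions on the cycle are taken on all integers so that
translations need no case distinctions; \<open>g n = g 0\<close> makes the values at \<open>r + 1\<close> uniform.\<close>

definition wrap :: "nat \<Rightarrow> (nat \<Rightarrow> real) \<Rightarrow> int \<Rightarrow> real" where
  "wrap n g k = g (nat (k mod int n))"

lemma wrap_cong: "k mod int n = l mod int n \<Longrightarrow> wrap n g k = wrap n g l"
  by (simp add: wrap_def)

lemma wrap_of_nat: "r < n \<Longrightarrow> wrap n g (int r) = g r"
  by (simp add: wrap_def flip: zmod_int)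

lemma wrap_neighbours:
  assumes "n > 0" "g n = g 0" and r: "r = nat (k mod int n)"
  shows "wrap n g k = g r" and "wrap n g (k + 1) = g (Suc r)"
    and "wrap n g (k - 1) = (if r = 0 then g (n - 1) else g (r - 1))"
    and "r < n" and "r = 0 \<longleftrightarrow> int n dvd k"
proof -
  have k: "k mod int n = int r" "r < n"
    using assms by (auto simp: nat_less_iff)
  show "wrap n g k = g r" by (simp add: wrap_def r)
  show "r < n" by (rule k)
  show "r = 0 \<longleftrightarrow> int n dvd k" using k by (simp add: dvd_eq_mod_eq_0)
  have "wrap n g (k + 1) = wrap n g (int (Suc r))"
    by (rule wrap_cong) (metis k(1) mod_add_left_eq of_nat_Suc add.commute)
  also have "\<dots> = g (Suc r)"
    using k(2) assms by (cases "Suc r = n") (auto simp: wrap_of_nat simp del: of_nat_Suc, simp add: wrap_def)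
  finally show "wrap n g (k + 1) = g (Suc r)" .
  have "wrap n g (k - 1) = wrap n g (int (if r = 0 then n - 1 else r - 1))"
  proof (rule wrap_cong)
    have "(k - 1) mod int n = (int r - 1) mod int n"
      by (metis k(1) mod_diff_left_eq)
    also have "\<dots> = int (if r = 0 then n - 1 else r - 1) mod int n"
    proof (cases "r = 0")
      case True
      have "(-1 :: int) mod int n = (-1 + int n) mod int n" by simp
      then show ?thesis using True \<open>n > 0\<close> by (simp add: of_nat_diff algebra_simps)
    qed (simp add: of_nat_diff)
    finally show "(k - 1) mod int n = int (if r = 0 then n - 1 else r - 1) mod int n" .
  qed
  also have "\<dots> = (if r = 0 then g (n - 1) else g (r - 1))"
    using k(2) wrap_of_nat[of "n - 1" n g] wrap_of_nat[of "r - 1" n g] by auto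
  finally show "wrap n g (k - 1) = (if r = 0 then g (n - 1) else g (r - 1))" .
qed

lemma wrap_minus:
  assumes "n > 0" "\<And>r. r \<le> n \<Longrightarrow> g (n - r) = g r"
  shows "wrap n g (- k) = wrap n g k"
proof -
  have "g n = g 0" using assms(2)[of 0] by simp
  define r where "r = nat (k mod int n)"
  have r: "int r = k mod int n" "r < n" using assms by (auto simp: r_def nat_less_iff)
  have "(- k) mod int n = (- int r) mod int n" by (simp add: r mod_minus_eq)
  also have "\<dots> = (- int r + int n) mod int n" by simp
  also have "\<dots> = int (n - r) mod int n" using r by (simp add: of_nat_diff)
  finally have "wrap n g (- k) = wrap n g (int (n - r))" by (rule wrap_cong)
  also have "\<dots> = g (n - r)"
    using wrap_of_nat[of "n - r" n g] r \<open>g n = g 0\<close> by (cases "r = 0") (auto simp: wrap_def)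
  also have "\<dots> = g r" using assms r by simp
  finally show ?thesis by (simp add: wrap_def r_def)
qed

text \<open>The Green function of the cycle.  A source of strength \<open>1\<close> must be balanced by a sink spread evenly
over all vertices, whence the constant second difference and the quadratic shape.\<close>

definition flat_kernel :: "nat \<Rightarrow> int \<Rightarrow> real" where
  "flat_kernel n = wrap n (\<lambda>r. - (real r * real (n - r)) / (2 * real n))"

lemma flat_kernel_equation:
  assumes "n \<ge> 2"
  shows "2 * flat_kernel n k - flat_kernel n (k + 1) - flat_kernel n (k - 1) =
    of_bool (int n dvd k) - 1 / real n"
proof -
  define g where "g = (\<lambda>r. - (real r * real (n - r)) / (2 * real n))"
  define r where "r = nat (k mod int n)"
  have "n > 0" "g n = g 0" using assms by (auto simp: g_def)
  note w = wrap_neighbours[OF this r_def]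
  have "real (n - r) = real n - real r" "real (n - Suc r) = real n - real r - 1"
    "r > 0 \<Longrightarrow> real (r - 1) = real r - 1" "r > 0 \<Longrightarrow> real (n - (r - 1)) = real n - real r + 1"
    "real (n - 1) = real n - 1"
    using w(4) assms by (auto simp: of_nat_diff)
  then show ?thesis
    unfolding flat_kernel_def g_def[symmetric] w(1-3) w(5)[symmetric]
    using \<open>n > 0\<close> by (auto simp: g_def field_simps)
qed

text \<open>The root in \<open>(0, 1)\<close> of \<open>q\<^sup>2 - 5 q + 1\<close>, the characteristic polynomial of
\<open>5 h(k) = h(k + 1) + h(k - 1)\<close>.\<close>

definition decay :: real where
  "decay = (5 - sqrt 21) / 2"

lemma decay_bounds: "0 < decay" "decay < 1"
proof -
  have "sqrt 21 < sqrt (5\<^sup>2)" "sqrt (3\<^sup>2) < sqrt 21" by (rule real_sqrt_less_mono; simp)+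
  then show "0 < decay" "decay < 1" by (auto simp: decay_def)
qed

lemma decay_root: "decay * decay = 5 * decay - 1"
  by (simp add: decay_def field_simps)

text \<open>The solution of the recurrence with a unit source at \<open>0\<close>, a superposition of decaying contributions
from both directions around the cycle.  The factor \<open>\<surd>21\<close> is \<open>1/q - q\<close>, and \<open>1 - q\<^sup>n\<close> sums the
geometric series over all windings.\<close>

definition massive_kernel :: "nat \<Rightarrow> int \<Rightarrow> real" where
  "massive_kernel n =
     wrap n (\<lambda>r. (decay ^ r + decay ^ (n - r)) / (sqrt 21 * (1 - decay ^ n)))"

lemma massive_kernel_equation:
  assumes "n \<ge> 2"
  shows "5 * massive_kernel n k - massive_kernel n (k + 1) - massive_kernel n (k - 1) =
    of_bool (int n dvd k)"
proof -
  define c where "c = sqrt 21 * (1 - decay ^ n)"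
  have "decay ^ n < 1" using decay_bounds assms by (simp add: power_Suc_less_one power_less_one_iff)
  then have "c \<noteq> 0" by (simp add: c_def)
  define g where "g = (\<lambda>r. (decay ^ r + decay ^ (n - r)) / c)"
  define r where "r = nat (k mod int n)"
  have "n > 0" "g n = g 0" using assms by (auto simp: g_def)
  note w = wrap_neighbours[OF this r_def]
  show ?thesis
  proof (cases "r = 0")
    case True
    have "decay ^ n = decay * decay ^ (n - 1)"
      using \<open>n > 0\<close> by (cases n) auto
    moreover have "sqrt 21 = 5 - 2 * decay" by (simp add: decay_def field_simps)
    moreover have "5 * (1 + y) - (d + x) - (x + d) = s * (1 - y)"
      if "y = d * x" "s = 5 - 2 * d" "d * d = 5 * d - 1" for d s x y :: real
    proof -
      have "(d * d) * x = (5 * d - 1) * x" unfolding that(3) ..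
      then show ?thesis unfolding that(1,2) by (simp add: algebra_simps)
    qed
    ultimately have "5 * (1 + decay ^ n) - (decay + decay ^ (n - 1)) - (decay ^ (n - 1) + decay) = c"
      unfolding c_def using decay_root by blast
    then have "5 * g 0 - g 1 - g (n - 1) = 1"
      using \<open>c \<noteq> 0\<close> assms unfolding g_def by (simp add: field_simps)
    then show ?thesis
      unfolding massive_kernel_def c_def[symmetric] g_def[symmetric] w(1-3) w(5)[symmetric]
      using True by simp
  next
    case False
    have rec: "5 * decay ^ Suc i - decay ^ Suc (Suc i) - decay ^ i = 0" for i
    proof -
      have "5 * decay ^ Suc i - decay ^ Suc (Suc i) - decay ^ i =
          (5 * decay - 1 - decay * decay) * decay ^ i"
        by (simp add: algebra_simps)
      then show ?thesis by (simp add: decay_root)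
    qed
    obtain i where i: "r = Suc i" using False by (cases r) auto
    obtain j where j: "n - r = Suc j" using w(4) by (cases "n - r") auto
    have "n - Suc r = j" "n - (r - 1) = Suc (Suc j)" using i j by auto
    then have "5 * g r - g (Suc r) - g (r - 1) =
        ((5 * decay ^ Suc i - decay ^ Suc (Suc i) - decay ^ i) +
         (5 * decay ^ Suc j - decay ^ Suc (Suc j) - decay ^ j)) / c"
      unfolding g_def j by (simp add: i add_divide_distrib diff_divide_distrib)
    then have "5 * g r - g (Suc r) - g (r - 1) = 0" unfolding rec by simp
    then show ?thesis
      unfolding massive_kernel_def c_def[symmetric] g_def[symmetric] w(1-3) w(5)[symmetric]
      using False by simp
  qed
qed

text \<open>The function \<open>\<delta>(p)\<close> on the triangle is the sum of the constant \<open>1/3\<close> and of \<open>\<delta>(p) - 1/3\<close>, which are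
eigenvectors of the Laplacian with eigenvalues \<open>0\<close> and \<open>3\<close>.  On the first component the torus
acts as the plain cycle, on the second the eigenvalue \<open>3\<close> is added to the diagonal entry \<open>2\<close>.\<close>

definition torus_kernel :: "nat \<Rightarrow> int \<Rightarrow> int \<Rightarrow> real" where
  "torus_kernel n p k = flat_kernel n k / 3 + (of_bool (3 dvd p) - 1 / 3) * massive_kernel n k"

text \<open>As on the cycle, the source is balanced by a sink spread evenly over all \<open>3n\<close> vertices.  This
background cancels as soon as two translates of the kernel are subtracted.\<close>

lemma torus_kernel_equation:
  assumes "n \<ge> 2"
  shows "4 * torus_kernel n p k - torus_kernel n (p + 1) k - torus_kernel n (p - 1) k -
      torus_kernel n p (k + 1) - torus_kernel n p (k - 1) =
    of_bool (3 dvd p \<and> int n dvd k) - 1 / (3 * real n)"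
proof -
  define d where "d = (\<lambda>p :: int. of_bool (3 dvd p) :: real)"
  have "3 dvd p \<and> \<not> 3 dvd (p + 1) \<and> \<not> 3 dvd (p - 1) \<or> \<not> 3 dvd p \<and> 3 dvd (p + 1) \<and> \<not> 3 dvd (p - 1) \<or>
      \<not> 3 dvd p \<and> \<not> 3 dvd (p + 1) \<and> 3 dvd (p - 1)"
    by presburger
  then have d: "d (p + 1) + d (p - 1) = 1 - d p" by (auto simp: d_def)
  have d_eq: "of_bool (3 dvd p) = d p" for p :: int by (simp add: d_def)
  have "4 * torus_kernel n p k - torus_kernel n (p + 1) k - torus_kernel n (p - 1) k -
      torus_kernel n p (k + 1) - torus_kernel n p (k - 1) =
      (2 * flat_kernel n k - flat_kernel n (k + 1) - flat_kernel n (k - 1)) / 3 +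
      (4 * (d p - 1 / 3) - (d (p + 1) + d (p - 1) - 2 / 3)) * massive_kernel n k -
      (d p - 1 / 3) * (massive_kernel n (k + 1) + massive_kernel n (k - 1))"
    unfolding torus_kernel_def d_eq by (simp add: field_simps)
  also have "\<dots> = (2 * flat_kernel n k - flat_kernel n (k + 1) - flat_kernel n (k - 1)) / 3 +
      (d p - 1 / 3) * (5 * massive_kernel n k - massive_kernel n (k + 1) - massive_kernel n (k - 1))"
    unfolding d by (simp add: field_simps)
  also have "\<dots> = of_bool (3 dvd p \<and> int n dvd k) - 1 / (3 * real n)"
    unfolding flat_kernel_equation[OF assms] massive_kernel_equation[OF assms] d_def
    by (cases "3 dvd p"; cases "int n dvd k") (simp_all add: field_simps)
  finally show ?thesis .
qed

lemma torus_kernel_cong: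
  assumes "3 dvd p - p'" "int n dvd k - k'"
  shows "torus_kernel n p k = torus_kernel n p' k'"
proof -
  have "3 dvd p \<longleftrightarrow> 3 dvd p'" using assms(1) by presburger
  moreover have "k mod int n = k' mod int n" using assms(2) by (simp add: mod_eq_dvd_iff)
  then have "wrap n g k = wrap n g k'" for g by (rule wrap_cong)
  ultimately show ?thesis
    unfolding torus_kernel_def flat_kernel_def massive_kernel_def by simp
qed

lemma torus_kernel_minus:
  assumes "n > 0"
  shows "torus_kernel n (- p) k = torus_kernel n p k" "torus_kernel n p (- k) = torus_kernel n p k"
proof -
  have "flat_kernel n (- k) = flat_kernel n k" "massive_kernel n (- k) = massive_kernel n k"
    unfolding flat_kernel_def massive_kernel_def
    by (rule wrap_minus[OF assms]; simp add: add.commute mult.commute)+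
  then show "torus_kernel n (- p) k = torus_kernel n p k" "torus_kernel n p (- k) = torus_kernel n p k"
    by (simp_all add: torus_kernel_def)
qed

section \<open>Geometry of the torus graph\<close>

definition cyc_suc :: "nat \<Rightarrow> nat \<Rightarrow> nat" where
  "cyc_suc m i = (if i = m then 1 else i + 1)"

definition cyc_pred :: "nat \<Rightarrow> nat \<Rightarrow> nat" where
  "cyc_pred m i = (if i = 1 then m else i - 1)"

lemma cyc_neighbours:
  assumes "m \<ge> 3" "i \<in> {1..m}"
  shows "cyc_suc m i \<in> {1..m}" "cyc_pred m i \<in> {1..m}"
    and "cyc_suc m i \<noteq> i" "cyc_pred m i \<noteq> i" "cyc_suc m i \<noteq> cyc_pred m i"
  using assms by (auto simp: cyc_suc_def cyc_pred_def)

lemma cyc_neighbours_dvd: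
  assumes "i \<in> {1..m}"
  shows "int m dvd int (cyc_suc m i) - (int i + 1)" "int m dvd int (cyc_pred m i) - (int i - 1)"
  using assms by (auto simp: cyc_suc_def cyc_pred_def of_nat_diff)

lemma cyc_eq_iff_dvd:
  assumes "i \<in> {1..m}" "j \<in> {1..m}"
  shows "int m dvd int i - int j \<longleftrightarrow> i = j"
proof
  assume "int m dvd int i - int j"
  moreover have "\<bar>int i - int j\<bar> < int m" using assms by auto
  ultimately show "i = j" using dvd_imp_le_int[of "int i - int j" "int m"] by fastforce
qed simp

lemma cyc_adjacent_iff:
  assumes "m \<ge> 3" "i \<in> {1..m}" "j \<in> {1..m}"
  shows "\<bar>int i - int j\<bar> \<in> {1, int m - 1} \<longleftrightarrow> j = cyc_suc m i \<or> j = cyc_pred m i"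
  using assms by (auto simp: cyc_suc_def cyc_pred_def)

abbreviation torus_verts :: "nat \<Rightarrow> nat \<Rightarrow> (nat \<times> nat) set" where
  "torus_verts m n \<equiv> {1..m} \<times> {1..n}"

abbreviation torus_edges :: "nat \<Rightarrow> nat \<Rightarrow> (nat \<times> nat) set set" where
  "torus_edges m n \<equiv> uedges (torus_ugraph m n)"

lemma torus_ugraph_eq: "torus_ugraph m n = (torus_verts m n, torus_edges m n)"
  by (simp add: torus_ugraph_def)

lemma torus_adjacent_sym: "torus_adjacent m n u v \<longleftrightarrow> torus_adjacent m n v u"
  by (auto simp: torus_adjacent_def abs_minus_commute)

lemma torus_edge_iff:
  "{u, v} \<in> torus_edges m n \<longleftrightarrow>
     u \<in> torus_verts m n \<and> v \<in> torus_verts m n \<and> torus_adjacent m n u v"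
  unfolding torus_ugraph_def snd_conv mem_Collect_eq doubleton_eq_iff
  using torus_adjacent_sym by blast

lemma nbrs_torus:
  assumes "m \<ge> 3" "n \<ge> 3" "(i, j) \<in> torus_verts m n"
  shows "nbrs (torus_edges m n) (i, j) =
    {(i, cyc_suc n j), (i, cyc_pred n j), (cyc_suc m i, j), (cyc_pred m i, j)}"
proof (intro set_eqI)
  fix x :: "nat \<times> nat"
  obtain k l where x: "x = (k, l)" by (cases x)
  have ij: "i \<in> {1..m}" "j \<in> {1..n}" using assms by auto
  show "x \<in> nbrs (torus_edges m n) (i, j) \<longleftrightarrow>
      x \<in> {(i, cyc_suc n j), (i, cyc_pred n j), (cyc_suc m i, j), (cyc_pred m i, j)}"
  proof (cases "k \<in> {1..m} \<and> l \<in> {1..n}")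
    case True
    then show ?thesis
      using assms(3) cyc_adjacent_iff[of m i k] cyc_adjacent_iff[of n j l] assms ij
      unfolding x nbrs_def mem_Collect_eq torus_edge_iff torus_adjacent_def fst_conv snd_conv
      by blast
  next
    case False
    then show ?thesis
      using cyc_neighbours[OF assms(1) ij(1)] cyc_neighbours[OF assms(2) ij(2)] ij
      unfolding x nbrs_def mem_Collect_eq torus_edge_iff by auto
  qed
qed

lemma torus_connected:
  assumes "m \<ge> 3" "n \<ge> 3" "u \<in> torus_verts m n" "v \<in> torus_verts m n"
  shows "(u, v) \<in> reach (torus_edges m n)"
proof -
  have to_origin: "((i, j), (1, 1)) \<in> reach (torus_edges m n)" if "i \<in> {1..m}" "j \<in> {1..n}" for i j
  proof -
    have "i \<ge> 1" "j \<ge> 1" using that by auto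
    have "((i, j), (i, 1)) \<in> reach (torus_edges m n)"
      using \<open>j \<ge> 1\<close> that(2)
    proof (induction j rule: dec_induct)
      case (step j)
      have "{(i, Suc j), (i, j)} \<in> torus_edges m n"
        using step.prems step.hyps that(1) by (simp add: torus_edge_iff torus_adjacent_def)
      then show ?case using step by (auto intro: reach_edge reach_trans)
    qed simp
    moreover have "((i, 1), (1, 1)) \<in> reach (torus_edges m n)"
      using \<open>i \<ge> 1\<close> that(1)
    proof (induction i rule: dec_induct)
      case (step i)
      have "{(Suc i, 1), (i, 1)} \<in> torus_edges m n"
        using step.prems step.hyps assms by (simp add: torus_edge_iff torus_adjacent_def)
      then show ?case using step by (auto intro: reach_edge reach_trans)
    qed simp
    ultimately show ?thesis by (rule reach_trans)
  qed
  obtain i j k l where "u = (i, j)" "v = (k, l)" by (cases u, cases v)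
  then show ?thesis
    using reach_trans[OF to_origin[of i j] reach_sym[OF to_origin[of k l]]] assms(3,4) by simp
qed

lemma card_torus_verts: "card (torus_verts 3 n) = 3 * n"
  by (simp add: card_cartesian_product)

lemma lap_torus:
  assumes "n \<ge> 3" "(i, j) \<in> torus_verts 3 n"
  shows "lap (torus_edges 3 n) f (i, j) = 4 * f (i, j) - f (cyc_suc 3 i, j) - f (cyc_pred 3 i, j) -
    f (i, cyc_suc n j) - f (i, cyc_pred n j)"
proof -
  have ij: "i \<in> {1..3}" "j \<in> {1..n}" using assms by auto
  have "distinct [(i, cyc_suc n j), (i, cyc_pred n j), (cyc_suc 3 i, j), (cyc_pred 3 i, j)]"
    using cyc_neighbours[OF order_refl ij(1)] cyc_neighbours[OF assms(1) ij(2)] by auto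
  then show ?thesis
    unfolding lap_def nbrs_torus[OF order_refl assms] by simp
qed

section \<open>Spanning trees of the torus with a given leaf\<close>

definition green :: "nat \<Rightarrow> nat \<times> nat \<Rightarrow> nat \<times> nat \<Rightarrow> real" where
  "green n x u = torus_kernel n (int (fst u) - int (fst x)) (int (snd u) - int (snd x))"

lemma green_eq_torus_kernel:
  assumes "3 dvd int (fst u) - (int (fst x) + p)" "int n dvd int (snd u) - (int (snd x) + k)"
  shows "green n x u = torus_kernel n p k"
  unfolding green_def
  by (rule torus_kernel_cong) (use assms in \<open>simp_all add: algebra_simps\<close>)

lemma lap_green:
  assumes "n \<ge> 3" "x \<in> torus_verts 3 n" "u \<in> torus_verts 3 n"
  shows "lap (torus_edges 3 n) (green n x) u = of_bool (u = x) - 1 / (3 * real n)"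
proof -
  obtain i j a b where ux: "u = (i, j)" "x = (a, b)" by (cases u, cases x)
  define p k where "p = int i - int a" and "k = int j - int b"
  have ij: "i \<in> {1..3}" "j \<in> {1..n}" and ab: "a \<in> {1..3}" "b \<in> {1..n}" using assms ux by auto
  have c3: "3 dvd int (cyc_suc 3 i) - (int i + 1)" "3 dvd int (cyc_pred 3 i) - (int i - 1)"
    using cyc_neighbours_dvd[OF ij(1)] by simp_all
  note cn = cyc_neighbours_dvd[OF ij(2)]
  have "green n x (cyc_suc 3 i, j) = torus_kernel n (p + 1) k"
    by (rule green_eq_torus_kernel) (use c3(1) in \<open>simp_all add: ux p_def k_def algebra_simps\<close>)
  moreover have "green n x (cyc_pred 3 i, j) = torus_kernel n (p - 1) k"
    by (rule green_eq_torus_kernel) (use c3(2) in \<open>simp_all add: ux p_def k_def algebra_simps\<close>)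
  moreover have "green n x (i, cyc_suc n j) = torus_kernel n p (k + 1)"
    by (rule green_eq_torus_kernel) (use cn(1) in \<open>simp_all add: ux p_def k_def algebra_simps\<close>)
  moreover have "green n x (i, cyc_pred n j) = torus_kernel n p (k - 1)"
    by (rule green_eq_torus_kernel) (use cn(2) in \<open>simp_all add: ux p_def k_def algebra_simps\<close>)
  moreover have "green n x (i, j) = torus_kernel n p k" by (simp add: green_def ux p_def k_def)
  moreover have "lap (torus_edges 3 n) (green n x) (i, j) = 4 * green n x (i, j) - green n x (cyc_suc 3 i, j) -
      green n x (cyc_pred 3 i, j) - green n x (i, cyc_suc n j) - green n x (i, cyc_pred n j)"
    using lap_torus[OF assms(1)] assms(3) unfolding ux by blast
  moreover have "n \<ge> 2" using assms(1) by simp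
  ultimately have "lap (torus_edges 3 n) (green n x) u = of_bool (3 dvd p \<and> int n dvd k) - 1 / (3 * real n)"
    unfolding ux(1) by (simp only: torus_kernel_equation)
  moreover have "3 dvd p \<longleftrightarrow> i = a"
    using cyc_eq_iff_dvd[OF ij(1) ab(1)] by (simp add: p_def)
  moreover have "int n dvd k \<longleftrightarrow> j = b"
    using cyc_eq_iff_dvd[OF ij(2) ab(2)] by (simp add: k_def)
  ultimately show ?thesis by (simp add: ux)
qed

lemma potential_green:
  assumes "n \<ge> 3" "v \<in> torus_verts 3 n" "x \<in> torus_verts 3 n"
  shows "potential (torus_verts 3 n) (torus_edges 3 n) v x (\<lambda>u. green n v u - green n x u)"
  unfolding potential_def lap_diff using lap_green assms by simp

text \<open>The determinant of \<open>I - K\<close> for the two edges at \<open>v\<close> along the long cycle and one edge along the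
triangle.  By the reflections of the torus, only four different entries occur in \<open>K\<close>: \<open>\<alpha>\<close> and \<open>\<delta>\<close>
on the diagonal, \<open>\<beta>\<close> between the two long edges and \<open>\<gamma>\<close> between a long and a short edge.\<close>

definition leaf_det :: "nat \<Rightarrow> real" where
  "leaf_det n =
    (let G = torus_kernel n;
       \<alpha> = 2 * G 0 0 - 2 * G 0 1;
       \<beta> = G 0 0 - 2 * G 0 1 + G 0 2;
       \<gamma> = G 0 0 - G 0 1 - G 1 0 + G 1 1;
       \<delta> = 2 * G 0 0 - 2 * G 1 0
     in det3 (1 - \<alpha>) (- \<beta>) (- \<gamma>) (- \<beta>) (1 - \<alpha>) (- \<gamma>) (- \<gamma>) (- \<gamma>) (1 - \<delta>))"

text \<open>The result is the same for all \<open>v\<close> because the potentials are translates of one kernel, so only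
differences of positions enter.  The two inequalities are the pivot conditions for the deletions;
they are verified below for all large \<open>n\<close>.\<close>

lemma card_leaf_trees_torus:
  assumes n: "n \<ge> 3" and v: "v \<in> torus_verts 3 n"
    and nz: "2 * torus_kernel n 0 0 - 2 * torus_kernel n 0 1 \<noteq> 1"
      "(1 - (2 * torus_kernel n 0 0 - 2 * torus_kernel n 0 1))\<^sup>2 \<noteq>
        (torus_kernel n 0 0 - 2 * torus_kernel n 0 1 + torus_kernel n 0 2)\<^sup>2"
  shows "real (card {T \<in> trees (torus_verts 3 n) (torus_edges 3 n). card {e \<in> T. v \<in> e} = 1}) =
    4 * real (card (trees (torus_verts 3 n) (torus_edges 3 n))) * leaf_det n"
proof -
  obtain i j where vij: "v = (i, j)" by (cases v)
  have ij: "i \<in> {1..3}" "j \<in> {1..n}" using v vij by auto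
  let ?V = "torus_verts 3 n" and ?E = "torus_edges 3 n"
  have G: "finite_simple_ugraph (?V, ?E)"
    using finite_simple_torus_ugraph[OF order_refl n] by (subst (asm) torus_ugraph_eq)
  define x\<^sub>1 x\<^sub>2 x\<^sub>3 x\<^sub>4 where x_def: "x\<^sub>1 = (i, cyc_suc n j)" "x\<^sub>2 = (i, cyc_pred n j)"
    "x\<^sub>3 = (cyc_suc 3 i, j)" "x\<^sub>4 = (cyc_pred 3 i, j)"
  note cyc = cyc_neighbours[of 3 i, OF order_refl ij(1)] cyc_neighbours[OF n ij(2)]
  have nbrs: "nbrs ?E v = {x\<^sub>1, x\<^sub>2, x\<^sub>3, x\<^sub>4}"
    unfolding vij x_def by (rule nbrs_torus) (use n v vij in auto)
  have dist: "distinct [x\<^sub>1, x\<^sub>2, x\<^sub>3, x\<^sub>4]" using cyc unfolding x_def by auto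
  then have card_nbrs: "card (nbrs ?E v) = 4" unfolding nbrs by simp
  have edges: "{v, x\<^sub>1} \<in> ?E" "{v, x\<^sub>2} \<in> ?E" "{v, x\<^sub>3} \<in> ?E" "x\<^sub>4 \<in> nbrs ?E v"
    using nbrs by (auto simp: nbrs_def)
  have xV: "x\<^sub>1 \<in> ?V" "x\<^sub>2 \<in> ?V" "x\<^sub>3 \<in> ?V" using nbrs_subset[OF G, of v] nbrs by auto
  have pend: "pendant_trees ?V ?E v x\<^sub>4 = trees ?V (?E - {{v, x\<^sub>1}, {v, x\<^sub>2}, {v, x\<^sub>3}})"
  proof -
    have "nbrs ?E v - {x\<^sub>4} = {x\<^sub>1, x\<^sub>2, x\<^sub>3}" using dist unfolding nbrs by auto
    then show ?thesis using pendant_trees_eq_trees[OF G edges(4)] by simp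
  qed
  define K where "K = torus_kernel n"
  have minus: "K (- p) k = K p k" "K p (- k) = K p k" for p k
    using torus_kernel_minus[of n] n by (auto simp: K_def)
  \<comment> \<open>Positions relative to \<open>v\<close>, modulo the two periods.\<close>
  define offset where "offset x p k \<longleftrightarrow> 3 dvd int (fst x) - (int i + p) \<and> int n dvd int (snd x) - (int j + k)"
    for x p k
  have offs: "offset v 0 0" "offset x\<^sub>1 0 1" "offset x\<^sub>2 0 (-1)" "offset x\<^sub>3 1 0"
    using cyc_neighbours_dvd[OF ij(1)] cyc_neighbours_dvd[OF ij(2)]
    by (auto simp: offset_def vij x_def)
  have green: "green n x y = K (q - p) (l - k)" if "offset x p k" "offset y q l" for x y p q k l
    unfolding K_def
  proof (rule green_eq_torus_kernel)
    show "3 dvd int (fst y) - (int (fst x) + (q - p))"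
      using dvd_diff[of 3 "int (fst y) - (int i + q)" "int (fst x) - (int i + p)"] that
      by (simp add: offset_def algebra_simps)
    show "int n dvd int (snd y) - (int (snd x) + (l - k))"
      using dvd_diff[of "int n" "int (snd y) - (int j + l)" "int (snd x) - (int j + k)"] that
      by (simp add: offset_def algebra_simps)
  qed
  have minus1: "K (-1) k = K 1 k" "K p (-1) = K p 1" "K p (-2) = K p 2" for p k
    using minus[of 1 k] minus[of p 1] minus[of p 2] by auto
  define f where "f x = (\<lambda>u. green n v u - green n x u)" for x
  have pot: "potential ?V ?E v x (f x)" if "x \<in> ?V" for x
    unfolding f_def by (rule potential_green[OF n v that])
  \<comment> \<open>The current flows from \<open>v\<close> to \<open>x\<close>; this is the voltage between \<open>v\<close> and \<open>y\<close>.\<close>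
  have drop: "f x v - f x y = K 0 0 - K (- p) (- k) - K q l + K (q - p) (l - k)"
    if "offset x p k" "offset y q l" for x y p q k l
    using green[OF offs(1) offs(1)] green[OF that(1) offs(1)] green[OF offs(1) that(2)] green[OF that]
    by (simp add: f_def)
  define \<alpha> \<beta> \<gamma> \<delta> where params: "\<alpha> = 2 * K 0 0 - 2 * K 0 1" "\<beta> = K 0 0 - 2 * K 0 1 + K 0 2"
    "\<gamma> = K 0 0 - K 0 1 - K 1 0 + K 1 1" "\<delta> = 2 * K 0 0 - 2 * K 1 0"
  have drops: "f x\<^sub>1 v - f x\<^sub>1 x\<^sub>1 = \<alpha>" "f x\<^sub>1 v - f x\<^sub>1 x\<^sub>2 = \<beta>" "f x\<^sub>1 v - f x\<^sub>1 x\<^sub>3 = \<gamma>"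
    "f x\<^sub>2 v - f x\<^sub>2 x\<^sub>1 = \<beta>" "f x\<^sub>2 v - f x\<^sub>2 x\<^sub>2 = \<alpha>" "f x\<^sub>2 v - f x\<^sub>2 x\<^sub>3 = \<gamma>"
    "f x\<^sub>3 v - f x\<^sub>3 x\<^sub>1 = \<gamma>" "f x\<^sub>3 v - f x\<^sub>3 x\<^sub>2 = \<gamma>" "f x\<^sub>3 v - f x\<^sub>3 x\<^sub>3 = \<delta>"
    using offs by (simp_all add: drop params minus1)
  have "real (card (trees ?V (?E - {{v, x\<^sub>1}, {v, x\<^sub>2}, {v, x\<^sub>3}}))) = real (card (trees ?V ?E)) *
      det3 (1 - \<alpha>) (- \<beta>) (- \<gamma>) (- \<beta>) (1 - \<alpha>) (- \<gamma>) (- \<gamma>) (- \<gamma>) (1 - \<delta>)"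
    using card_trees_delete_three_edges[OF G edges(1-3) _ _ _ pot[OF xV(1)] pot[OF xV(2)] pot[OF xV(3)]]
      dist nz unfolding drops by (simp add: params K_def power2_eq_square)
  also have "\<dots> = real (card (trees ?V ?E)) * leaf_det n"
    by (simp add: leaf_det_def Let_def params K_def)
  finally show ?thesis
    unfolding card_leaf_trees[OF G edges(4)] card_nbrs pend by simp
qed

section \<open>The limit\<close>

text \<open>Only the direct contribution survives; the one from around the cycle has length \<open>n - r\<close>.\<close>

lemma massive_kernel_limit:
  "(\<lambda>n. massive_kernel n (int r)) \<longlonglongrightarrow> decay ^ r / sqrt 21"
proof -
  have pow: "(\<lambda>n. decay ^ n) \<longlonglongrightarrow> 0"
    using decay_bounds by (intro LIMSEQ_power_zero) simp
  have "filterlim (\<lambda>n. n - r) at_top at_top" by (rule filterlim_minus_const_nat_at_top)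
  then have "(\<lambda>n. decay ^ (n - r)) \<longlonglongrightarrow> 0" by (rule filterlim_compose[OF pow])
  then have "(\<lambda>n. (decay ^ r + decay ^ (n - r)) / (sqrt 21 * (1 - decay ^ n)))
      \<longlonglongrightarrow> (decay ^ r + 0) / (sqrt 21 * (1 - 0))"
    by (intro tendsto_intros pow) auto
  moreover have "\<forall>\<^sub>F n in sequentially.
      (decay ^ r + decay ^ (n - r)) / (sqrt 21 * (1 - decay ^ n)) = massive_kernel n (int r)"
    using eventually_gt_at_top[of r]
    by eventually_elim (simp add: massive_kernel_def wrap_of_nat)
  ultimately show ?thesis by (simp add: filterlim_cong)
qed

lemma flat_kernel_limit:
  "(\<lambda>n. flat_kernel n (int r)) \<longlonglongrightarrow> - real r / 2"
proof -
  have "(\<lambda>n. - real r / 2 + (real r)\<^sup>2 / 2 * (1 / real n)) \<longlonglongrightarrow> - real r / 2 + (real r)\<^sup>2 / 2 * 0"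
    by (intro tendsto_intros lim_1_over_n)
  moreover have "\<forall>\<^sub>F n in sequentially. - real r / 2 + (real r)\<^sup>2 / 2 * (1 / real n) = flat_kernel n (int r)"
    using eventually_gt_at_top[of r]
    by eventually_elim
      (simp add: flat_kernel_def wrap_of_nat of_nat_diff field_simps power2_eq_square)
  ultimately show ?thesis by (simp add: filterlim_cong)
qed

lemma torus_kernel_limit:
  "(\<lambda>n. torus_kernel n p (int r)) \<longlonglongrightarrow>
    - real r / 6 + (of_bool (3 dvd p) - 1 / 3) * (decay ^ r / sqrt 21)"
proof -
  have "(\<lambda>n. torus_kernel n p (int r)) \<longlonglongrightarrow>
      (- real r / 2) / 3 + (of_bool (3 dvd p) - 1 / 3) * (decay ^ r / sqrt 21)"
    unfolding torus_kernel_def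
    by (intro tendsto_intros flat_kernel_limit massive_kernel_limit) simp
  then show ?thesis by simp
qed

text \<open>All powers of \<open>q\<close> reduce to linear expressions in \<open>\<surd>21\<close> by \<open>q\<^sup>2 = 5 q - 1\<close>.\<close>

lemma torus_kernel_limits:
  "(\<lambda>n. torus_kernel n 0 0) \<longlonglongrightarrow> 2 * sqrt 21 / 63"
  "(\<lambda>n. torus_kernel n 1 0) \<longlonglongrightarrow> - sqrt 21 / 63"
  "(\<lambda>n. torus_kernel n 0 1) \<longlonglongrightarrow> 5 * sqrt 21 / 63 - 1 / 2"
  "(\<lambda>n. torus_kernel n 1 1) \<longlonglongrightarrow> - 5 * sqrt 21 / 126"
  "(\<lambda>n. torus_kernel n 0 2) \<longlonglongrightarrow> 23 * sqrt 21 / 63 - 2"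
proof -
  have s: "1 / sqrt 21 = sqrt 21 / 21" by (simp add: field_simps)
  have d1: "decay / sqrt 21 = 5 * sqrt 21 / 42 - 1 / 2" by (simp add: decay_def field_simps)
  have d2: "decay\<^sup>2 / sqrt 21 = 23 * sqrt 21 / 42 - 5 / 2"
    unfolding power2_eq_square decay_root by (simp add: decay_def field_simps)
  show "(\<lambda>n. torus_kernel n 0 0) \<longlonglongrightarrow> 2 * sqrt 21 / 63"
    using torus_kernel_limit[of 0 0] by (simp add: s)
  show "(\<lambda>n. torus_kernel n 1 0) \<longlonglongrightarrow> - sqrt 21 / 63"
    using torus_kernel_limit[of 1 0] by (simp add: s)
  show "(\<lambda>n. torus_kernel n 0 1) \<longlonglongrightarrow> 5 * sqrt 21 / 63 - 1 / 2"
    using torus_kernel_limit[of 0 1] by (simp add: d1 algebra_simps)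
  show "(\<lambda>n. torus_kernel n 1 1) \<longlonglongrightarrow> - 5 * sqrt 21 / 126"
    using torus_kernel_limit[of 1 1] by (simp add: d1 algebra_simps)
  show "(\<lambda>n. torus_kernel n 0 2) \<longlonglongrightarrow> 23 * sqrt 21 / 63 - 2"
    using torus_kernel_limit[of 0 2] by (simp add: d2 algebra_simps)
qed

lemma leaf_det_limit: "(\<lambda>n. leaf_det n) \<longlonglongrightarrow> (6 * sqrt 21 - 26) / 21"
proof -
  let ?G = torus_kernel
  have lims: "(\<lambda>n. 1 - (2 * ?G n 0 0 - 2 * ?G n 0 1)) \<longlonglongrightarrow> 2 * sqrt 21 / 21"
    "(\<lambda>n. - (?G n 0 0 - 2 * ?G n 0 1 + ?G n 0 2)) \<longlonglongrightarrow> 1 - 5 * sqrt 21 / 21"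
    "(\<lambda>n. - (?G n 0 0 - ?G n 0 1 - ?G n 1 0 + ?G n 1 1)) \<longlonglongrightarrow> sqrt 21 / 14 - 1 / 2"
    "(\<lambda>n. 1 - (2 * ?G n 0 0 - 2 * ?G n 1 0)) \<longlonglongrightarrow> 1 - 2 * sqrt 21 / 21"
    by (auto intro!: tendsto_eq_intros torus_kernel_limits simp: field_simps)
  show ?thesis
    unfolding leaf_det_def Let_def det3_def
    by (rule tendsto_eq_rhs, (rule tendsto_add tendsto_diff tendsto_mult lims)+) (simp add: field_simps)
qed

text \<open>For large \<open>n\<close> the pivots are close to their limits, which do not vanish: the first pivot tends to
\<open>2 \<surd>21 / 21\<close>, and the product of the first two to a nonzero number because \<open>\<surd>21 \<noteq> 21 / 5\<close>.\<close>

lemma leaf_ratio_torus: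
  "\<forall>\<^sub>F n in sequentially.
    real (\<Sum>T\<in>ugraph_spanning_trees (torus_ugraph 3 n). card (ugraph_leaves T)) /
      (3 * real n * real (ugraph_tau (torus_ugraph 3 n))) = 4 * leaf_det n"
proof -
  let ?\<alpha> = "\<lambda>n. 2 * torus_kernel n 0 0 - 2 * torus_kernel n 0 1"
  let ?\<beta> = "\<lambda>n. torus_kernel n 0 0 - 2 * torus_kernel n 0 1 + torus_kernel n 0 2"
  have lim_\<alpha>: "?\<alpha> \<longlonglongrightarrow> 1 - 2 * sqrt 21 / 21"
    and lim_\<beta>: "?\<beta> \<longlonglongrightarrow> 5 * sqrt 21 / 21 - 1"
    by (auto intro!: tendsto_eq_intros torus_kernel_limits simp: field_simps)
  have "\<forall>\<^sub>F n in sequentially. ?\<alpha> n \<noteq> 1"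
    by (rule tendsto_imp_eventually_ne[OF lim_\<alpha>]) simp
  moreover have "(\<lambda>n. (1 - ?\<alpha> n)\<^sup>2 - (?\<beta> n)\<^sup>2) \<longlonglongrightarrow>
      (1 - (1 - 2 * sqrt 21 / 21))\<^sup>2 - (5 * sqrt 21 / 21 - 1)\<^sup>2"
    by (intro tendsto_intros lim_\<alpha> lim_\<beta>)
  then have "\<forall>\<^sub>F n in sequentially. (1 - ?\<alpha> n)\<^sup>2 - (?\<beta> n)\<^sup>2 \<noteq> 0"
  proof (rule tendsto_imp_eventually_ne)
    have "21 / 5 < sqrt 21" by (rule real_less_rsqrt) (simp add: power2_eq_square)
    then show "(1 - (1 - 2 * sqrt 21 / 21))\<^sup>2 - (5 * sqrt 21 / 21 - 1)\<^sup>2 \<noteq> (0 :: real)"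
      by (simp add: power2_eq_square field_simps)
  qed
  ultimately show ?thesis
    using eventually_ge_at_top[of 3]
  proof eventually_elim
    case (elim n)
    let ?V = "torus_verts 3 n" and ?E = "torus_edges 3 n"
    have G: "finite_simple_ugraph (?V, ?E)"
      using finite_simple_torus_ugraph[OF order_refl elim(3)] by (subst (asm) torus_ugraph_eq)
    have ne: "?V \<noteq> {}" using elim(3) by auto
    have "trees ?V ?E \<noteq> {}"
      by (rule trees_nonempty[OF G torus_connected]) (use elim(3) in auto)
    then have tau: "ugraph_tau (torus_ugraph 3 n) = card (trees ?V ?E)" "card (trees ?V ?E) > 0"
      using tau_eq_card_trees[OF G ne, folded torus_ugraph_eq] finite_trees[OF G]
      by (simp_all add: card_gt_0_iff)
    have "real (\<Sum>T\<in>ugraph_spanning_trees (torus_ugraph 3 n). card (ugraph_leaves T)) =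
        (\<Sum>v\<in>?V. 4 * real (card (trees ?V ?E)) * leaf_det n)"
      unfolding sum_leaves_eq[OF G ne, folded torus_ugraph_eq]
      by (intro sum.cong refl card_leaf_trees_torus) (use elim in auto)
    also have "\<dots> = 3 * real n * real (card (trees ?V ?E)) * (4 * leaf_det n)"
      using card_torus_verts[of n] by simp
    finally show ?case using tau elim(3) by simp
  qed
qed

lemma eventually_members_at_top:
  "eventually P (members_at_top \<F>) \<longleftrightarrow> (\<exists>N. \<forall>G\<in>\<F>. N \<le> card (uverts G) \<longrightarrow> P G)"
  unfolding members_at_top_def inf.commute[of "principal _"] eventually_inf_principal
    eventually_filtercomap_at_top_linorder
  by blast

text \<open>The order \<open>3 n\<close> determines \<open>n\<close>, so members of large order are those with large \<open>n\<close>.\<close>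

lemma has_BZ_constant_torusI:
  assumes "(\<lambda>n. BZ_ratio (torus_ugraph 3 n)) \<longlonglongrightarrow> c"
  shows "has_BZ_constant {torus_ugraph 3 n |n. n \<ge> 3} c"
proof -
  have order: "card (uverts (torus_ugraph 3 n)) = 3 * n" for n
    using card_torus_verts[of n] by (simp add: torus_ugraph_def)
  have "\<not> eventually (\<lambda>_. False) (members_at_top {torus_ugraph 3 n |n. n \<ge> 3})"
    unfolding eventually_members_at_top
  proof
    assume "\<exists>N. \<forall>G\<in>{torus_ugraph 3 n |n. n \<ge> 3}. N \<le> card (uverts G) \<longrightarrow> False"
    then obtain N where "\<forall>G\<in>{torus_ugraph 3 n |n. n \<ge> 3}. N \<le> card (uverts G) \<longrightarrow> False" ..
    then have "\<not> N \<le> card (uverts (torus_ugraph 3 (N + 3)))" by fastforce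
    then show False unfolding order by simp
  qed
  moreover have "(BZ_ratio \<longlongrightarrow> c) (members_at_top {torus_ugraph 3 n |n. n \<ge> 3})"
  proof (rule topological_tendstoI)
    fix S assume "open S" "c \<in> S"
    with assms have "\<forall>\<^sub>F n in sequentially. BZ_ratio (torus_ugraph 3 n) \<in> S"
      by (rule topological_tendstoD)
    then obtain N where "\<forall>n\<ge>N. BZ_ratio (torus_ugraph 3 n) \<in> S"
      unfolding eventually_sequentially ..
    then show "\<forall>\<^sub>F G in members_at_top {torus_ugraph 3 n |n. n \<ge> 3}. BZ_ratio G \<in> S"
      unfolding eventually_members_at_top
    proof (intro exI[of _ "3 * N"] ballI impI)
      fix G assume G: "G \<in> {torus_ugraph 3 n |n. n \<ge> 3}" and card: "3 * N \<le> card (uverts G)"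
      then obtain n where n: "G = torus_ugraph 3 n" by blast
      have "N \<le> n" using card unfolding n order by simp
      then show "BZ_ratio G \<in> S" using \<open>\<forall>n\<ge>N. BZ_ratio (torus_ugraph 3 n) \<in> S\<close> n by blast
    qed
  qed
  ultimately show ?thesis by (auto simp: has_BZ_constant_def eventually_False)
qed

theorem theorem7p0p2:
  shows "has_BZ_constant {torus_ugraph 3 n |n. n \<ge> 3} ((24 * sqrt 21 - 104) / 21) \<and>
    (\<lambda>n. real (\<Sum>T\<in>ugraph_spanning_trees (torus_ugraph 3 n). card (ugraph_leaves T)) /
            (3 * real n * real (ugraph_tau (torus_ugraph 3 n))))
      \<longlonglongrightarrow> (24 * sqrt 21 - 104) / 21"
proof -
  have "(\<lambda>n. 4 * leaf_det n) \<longlonglongrightarrow> 4 * ((6 * sqrt 21 - 26) / 21)"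
    by (intro tendsto_intros leaf_det_limit)
  also have "4 * ((6 * sqrt 21 - 26) / 21) = (24 * sqrt 21 - 104) / 21" by simp
  finally have lim: "(\<lambda>n. real (\<Sum>T\<in>ugraph_spanning_trees (torus_ugraph 3 n). card (ugraph_leaves T)) /
      (3 * real n * real (ugraph_tau (torus_ugraph 3 n)))) \<longlonglongrightarrow> (24 * sqrt 21 - 104) / 21"
    using filterlim_cong[OF refl refl leaf_ratio_torus] by blast
  have "BZ_ratio (torus_ugraph 3 n) =
      real (\<Sum>T\<in>ugraph_spanning_trees (torus_ugraph 3 n). card (ugraph_leaves T)) /
      (3 * real n * real (ugraph_tau (torus_ugraph 3 n)))" for n
    using card_torus_verts[of n] by (simp add: BZ_ratio_def torus_ugraph_def)
  then have "(\<lambda>n. BZ_ratio (torus_ugraph 3 n)) \<longlonglongrightarrow> (24 * sqrt 21 - 104) / 21"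
    using lim by simp
  then show ?thesis using has_BZ_constant_torusI lim by blast
qed

end
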